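(* For every $\eta\in(0,1)$ there exists a constant $C\ge1$ such that the following holds. Let $\phi\colon\mathbb{R}\to\mathbb{R}^2$ be $1$-tame. Then there exists a decomposition $\mathcal{D}=\mathcal{B}\,\dot\cup\,\mathcal{G}$ of the dyadic intervals of $\mathbb{R}$ into two disjoint subfamilies with the following properties. First, the intervals in $\mathcal{B}$ satisfy a Carleson packing condition: $$\sum_{Q\in\mathcal{B},\,Q\subset Q_0}|Q|\le C|Q_0|,\qquad Q_0\in\mathcal{D}.$$ Second, $\mathcal{G}$ can be written as a union $\mathcal{G}=\bigcup_{\mathcal{T}\in\mathcal{F}}\mathcal{T}$, where $\mathcal{F}$ is a family of disjoint trees $\mathcal{T}\subset\mathcal{D}$, whose top intervals satisfy $$\sum_{\mathcal{T}\in\mathcal{F},\,Q(\mathcal{T})\subset Q_0}|Q(\mathcal{T})|\le C|Q_0|,\qquad Q_0\in\mathcal{D}.$$ For every $\mathcal{T}\in\mathcal{F}$ there exist a $2$-tame-linear map $\mathcal{L}_{\mathcal{T}}\colon\mathbb{R}\to\mathbb{R}^2$ and an $\eta$-tame map $\psi_{\mathcal{T}}\colon\mathbb{R}\to\mathbb{R}^2$ such that $$d_\pi\big(\phi(s),[\psi_{\mathcal{T}}+\mathcal{L}_{\mathcal{T}}](s)\big)\le\eta|Q|,\qquad s\in2Q,\ Q\in\mathcal{T}.$$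
   Context: Tame maps: for $E\subset\mathbb{R}$ and $L\ge0$, a map $(\phi_1,\phi_2)\colon E\to\mathbb{R}^2$ is $L$-tame if $$\left|\frac{\phi_2(x)-\phi_2(y)}{x-y}-\phi_1(x)\right|+\left|\frac{\phi_2(x)-\phi_2(y)}{x-y}-\phi_1(y)\right|\le L|x-y|,\qquad x,y\in E,\ x\ne y.$$ A map $\phi=(\phi_1,\phi_2)\colon\mathbb{R}\to\mathbb{R}^2$ is tame-linear if $\phi_1$ is linear and $\phi_2$ is differentiable with $\dot\phi_2=\phi_1$; it is $L$-tame-linear if moreover $\phi_1$ is $L$-Lipschitz. $\mathcal{D}$ denotes the standard dyadic intervals of $\mathbb{R}$, $|Q|$ the length of $Q$, and $2Q$ the interval with the same midpoint as $Q$ and twice the length. A collection $\mathcal{T}\subset\mathcal{D}$ is a tree if (T1) $\mathcal{T}$ contains a top interval $Q(\mathcal{T})$, that is, a unique maximal element (with respect to inclusion); (T2) if $Q\in\mathcal{T}$, then $Q'\in\mathcal{T}$ for all $Q'\in\mathcal{D}$ with $Q\subset Q'\subset Q(\mathcal{T})$; (T3) if $Q\in\mathcal{T}$, then either both or neither of the two dyadic children of $Q$ lie in $\mathcal{T}$. $d_\pi$ is the parabolic metric $d_\pi((x,s),(y,t)):=\max\{|x-y|,\sqrt{|s-t|}\}$ on $\mathbb{R}^2$. *)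

theory Defs
  imports "HOL-Analysis.Analysis"
begin

definition tame_on :: "real \<Rightarrow> real set \<Rightarrow> (real \<Rightarrow> real \<times> real) \<Rightarrow> bool" where
  "tame_on L E \<phi> \<longleftrightarrow>
    (\<forall>x\<in>E. \<forall>y\<in>E. x \<noteq> y \<longrightarrow>
      \<bar>(snd (\<phi> x) - snd (\<phi> y)) / (x - y) - fst (\<phi> x)\<bar> +
      \<bar>(snd (\<phi> x) - snd (\<phi> y)) / (x - y) - fst (\<phi> y)\<bar> \<le> L * \<bar>x - y\<bar>)"

text \<open>Linear is meant in the strict sense, \<open>\<phi>\<^sub>1 s = a * s\<close>; the second component
  still carries a free additive constant.\<close>

definition tame_linear :: "(real \<Rightarrow> real \<times> real) \<Rightarrow> bool" where
  "tame_linear \<phi> \<longleftrightarrow>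
    linear (\<lambda>s. fst (\<phi> s)) \<and>
    (\<forall>s. ((\<lambda>t. snd (\<phi> t)) has_real_derivative fst (\<phi> s)) (at s))"

definition L_tame_linear :: "real \<Rightarrow> (real \<Rightarrow> real \<times> real) \<Rightarrow> bool" where
  "L_tame_linear L \<phi> \<longleftrightarrow> tame_linear \<phi> \<and> L-lipschitz_on UNIV (\<lambda>s. fst (\<phi> s))"

definition dyadic_intervals :: "real set set" where
  "dyadic_intervals =
    {{of_int k * 2 powi j ..< (of_int k + 1) * 2 powi j} | (j::int) (k::int). True}"

definition len :: "real set \<Rightarrow> real" where
  "len Q = measure lborel Q"

definition midpt :: "real set \<Rightarrow> real" where
  "midpt Q = (Inf Q + Sup Q) / 2"

text \<open>Half-open like the dyadic intervals themselves.\<close>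

definition double_interval :: "real set \<Rightarrow> real set" where
  "double_interval Q = {midpt Q - len Q ..< midpt Q + len Q}"

definition dyadic_children :: "real set \<Rightarrow> real set set" where
  "dyadic_children Q = {R \<in> dyadic_intervals. R \<subseteq> Q \<and> len R = len Q / 2}"

text \<open>The top interval is the largest element with respect to inclusion, hence the unique
  maximal one. Asking only for a unique maximal element would also admit collections with an
  unbounded ascending chain of intervals not contained in the top.\<close>

definition top_interval :: "real set set \<Rightarrow> real set" where
  "top_interval T = (GREATEST Q. Q \<in> T)"

definition dyadic_tree :: "real set set \<Rightarrow> bool" where
  "dyadic_tree T \<longleftrightarrow>
    T \<subseteq> dyadic_intervals \<and>
    (\<exists>Q\<in>T. \<forall>R\<in>T. R \<subseteq> Q) \<and>
    (\<forall>Q\<in>T. \<forall>Q'\<in>dyadic_intervals. Q \<subseteq> Q' \<and> Q' \<subseteq> top_interval T \<longrightarrow> Q' \<in> T) \<and>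
    (\<forall>Q\<in>T. dyadic_children Q \<subseteq> T \<or> dyadic_children Q \<inter> T = {})"

definition d_par :: "real \<times> real \<Rightarrow> real \<times> real \<Rightarrow> real" where
  "d_par p q = max \<bar>fst p - fst q\<bar> (sqrt \<bar>snd p - snd q\<bar>)"

end

theory Submission
  imports Defs
begin

text \<open>A 1-tame map is a pair \<open>(f, F)\<close> of a 1-Lipschitz function and its primitive. Bad intervals are those
  near which \<open>f\<close> is not \<open>\<epsilon>\<close>-close to affine; they are packed because the slopes of \<open>f\<close> on the dyadic
  intervals form a bounded martingale, whose square function also controls the jumps of the slope
  between adjacent intervals that are not siblings. A tree is stopped at bad intervals and where the
  slope differs from the slope \<open>a\<close> at its top by more than \<open>\<epsilon>\<close>. After subtracting \<open>(a s, a s\<^sup>2 / 2)\<close>, the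
  1-jet of the map has small constants on the endpoints of the intervals of the tree, and its Whitney
  extension by cubic interpolation in the gaps is the map \<open>\<psi>\<close>. Since \<open>\<psi>\<close> agrees with the map at an
  endpoint of each interval of the tree, the estimate on \<open>2Q\<close> follows by Taylor's formula.\<close>

section \<open>Whitney extension of 1-jets on the line\<close>

text \<open>The map minus \<open>\<L>\<close> cannot itself serve as \<open>\<psi>\<close>: inside
  the intervals where a tree has stopped, the slope of \<open>f\<close> may differ from
  \<open>a\<close> by far more than \<open>\<epsilon>\<close>. The gaps have to be filled afresh,
  and the pieces glued without the constant growing with their number. Flatness is measured on the
  triple of an interval, because the triple contains \<open>2Q\<close> and is wide enough to hold
  both of the endpoints that are compared; the price is that jumps between non-siblings must be
  packed as well. The metric takes a square root of the second component, whose error on an interval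
  of length \<open>h\<close> is of order \<open>\<epsilon> * h\<^sup>2\<close>. This forces
  \<open>\<epsilon>\<close> to be of order \<open>\<eta>\<^sup>2\<close>. The factor 1/1000 covers
  the losses: 8 for the oscillation on an interval of the tree, 2 for replacing a distance by a
  dyadic length, 10 for the interpolation, then 3 for tameness, or 2 for reversing a jet together
  with the size of \<open>2Q\<close>.\<close>

definition jet :: "real \<Rightarrow> (real \<Rightarrow> real) \<Rightarrow> (real \<Rightarrow> real) \<Rightarrow> real \<Rightarrow> real \<Rightarrow> bool" where
  "jet L g G x y \<longleftrightarrow> \<bar>g y - g x\<bar> \<le> L * \<bar>y - x\<bar> \<and> \<bar>G y - G x - g x * (y - x)\<bar> \<le> L * (y - x)\<^sup>2"

lemma jet_refl: "jet L g G x x"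
  by (simp add: jet_def)

lemma jet_mono: "jet L g G x y \<Longrightarrow> L \<le> M \<Longrightarrow> jet M g G x y"
  unfolding jet_def by (meson abs_ge_zero mult_right_mono order_trans zero_le_power2)

text \<open>The Taylor remainders add up to that of the whole step except for the cross term
  \<open>(g z - g x) * (y - z)\<close>, at most \<open>L * s * t\<close>. As
  \<open>s\<^sup>2 + s * t + t\<^sup>2 \<le> (s + t)\<^sup>2\<close>, chaining ordered points loses
  no constant; the gluing below rests on this.\<close>

lemma jet_trans:
  assumes xz: "jet L g G x z" and zy: "jet L g G z y" and "x \<le> z" "z \<le> y"
  shows "jet L g G x y"
proof -
  define s t where "s = z - x" and "t = y - z"
  have st: "s \<ge> 0" "t \<ge> 0" "y - x = s + t" using assms by (auto simp: s_def t_def)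
  have 1: "\<bar>g z - g x\<bar> \<le> L * s" "\<bar>g y - g z\<bar> \<le> L * t"
    using xz zy st by (auto simp: jet_def s_def t_def)
  have "\<bar>g y - g x\<bar> \<le> L * s + L * t" using 1 by linarith
  hence A: "\<bar>g y - g x\<bar> \<le> L * \<bar>y - x\<bar>" using st by (simp add: algebra_simps)
  have 2: "\<bar>G z - G x - g x * s\<bar> \<le> L * s\<^sup>2" "\<bar>G y - G z - g z * t\<bar> \<le> L * t\<^sup>2"
    using xz zy by (auto simp: jet_def s_def t_def)
  have 3: "\<bar>(g z - g x) * t\<bar> \<le> L * s * t"
    using mult_right_mono[OF 1(1) st(2)] st by (simp add: abs_mult)
  have Lst: "0 \<le> L * s * t" using 3 by linarith
  have "G y - G x - g x * (y - x) =
      (G z - G x - g x * s) + (G y - G z - g z * t) + (g z - g x) * t"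
    unfolding st(3) by (simp add: algebra_simps)
  hence "\<bar>G y - G x - g x * (y - x)\<bar> \<le> L * s\<^sup>2 + L * t\<^sup>2 + L * s * t"
    using 2 3 by linarith
  also have "\<dots> \<le> L * (y - x)\<^sup>2"
    unfolding st(3) using Lst by (simp add: power2_eq_square algebra_simps)
  finally show ?thesis using A by (simp add: jet_def)
qed

text \<open>A jet is expanded at its first point only. Moving the base point adds
  \<open>(g y - g x) * (y - x)\<close>, which the Lipschitz bound controls by another
  \<open>L * (y - x)\<^sup>2\<close>.\<close>

lemma jet_sym:
  assumes "jet L g G x y" shows "jet (2 * L) g G y x"
proof -
  have a: "\<bar>g y - g x\<bar> \<le> L * \<bar>y - x\<bar>" and b: "\<bar>G y - G x - g x * (y - x)\<bar> \<le> L * (y - x)\<^sup>2"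
    using assms by (auto simp: jet_def)
  have c: "\<bar>(g y - g x) * (y - x)\<bar> \<le> L * (y - x)\<^sup>2"
    using mult_right_mono[OF a, of "\<bar>y - x\<bar>"] by (simp add: abs_mult power2_eq_square mult.assoc)
  have "G x - G y - g y * (x - y) = (g y - g x) * (y - x) - (G y - G x - g x * (y - x))"
    by (simp add: algebra_simps)
  hence "\<bar>G x - G y - g y * (x - y)\<bar> \<le> 2 * L * (x - y)\<^sup>2"
    using b c by (simp add: power2_commute[of x y])
  moreover have "0 \<le> L * \<bar>y - x\<bar>" using a by linarith
  ultimately show ?thesis using a by (simp add: jet_def abs_minus_commute)
qed

text \<open>The two terms of tameness are the Taylor remainders at the two points divided by the
  distance: \<open>L\<close> at the left point and, after reversal, \<open>2 * L\<close> at the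
  right one.\<close>

lemma jet_imp_tame_on:
  assumes "\<And>x y. x < y \<Longrightarrow> jet L g G x y"
  shows "tame_on (3 * L) E (\<lambda>x. (g x, G x))"
proof -
  have key: "\<bar>(G y - G x) / (y - x) - g x\<bar> \<le> M * \<bar>y - x\<bar>" if "jet M g G x y" "x \<noteq> y" for x y M
  proof -
    have "(G y - G x) / (y - x) - g x = (G y - G x - g x * (y - x)) / (y - x)"
      using that by (simp add: field_simps)
    hence "\<bar>(G y - G x) / (y - x) - g x\<bar> = \<bar>G y - G x - g x * (y - x)\<bar> / \<bar>y - x\<bar>" by simp
    also have "\<dots> \<le> (M * \<bar>y - x\<bar> * \<bar>y - x\<bar>) / \<bar>y - x\<bar>"
      using that by (intro divide_right_mono) (auto simp: jet_def power2_eq_square)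
    finally show ?thesis using that by simp
  qed
  have main: "\<bar>(G y - G x) / (y - x) - g x\<bar> + \<bar>(G y - G x) / (y - x) - g y\<bar> \<le> 3 * L * \<bar>y - x\<bar>"
    if "x < y" for x y
  proof -
    have "(G x - G y) / (x - y) = (G y - G x) / (y - x)" by (metis minus_diff_eq minus_divide_divide)
    thus ?thesis
      using key[OF assms[OF that]] key[OF jet_sym[OF assms[OF that]]] that by auto
  qed
  show ?thesis
    unfolding tame_on_def
  proof (intro ballI impI)
    fix x y :: real assume "x \<noteq> y"
    have e: "(G x - G y) / (x - y) = (G y - G x) / (y - x)" by (metis minus_diff_eq minus_divide_divide)
    show "\<bar>(snd (g x, G x) - snd (g y, G y)) / (x - y) - fst (g x, G x)\<bar> +
          \<bar>(snd (g x, G x) - snd (g y, G y)) / (x - y) - fst (g y, G y)\<bar> \<le> 3 * L * \<bar>x - y\<bar>"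
    proof (cases "x < y")
      case True thus ?thesis using main[of x y] e by (simp add: abs_minus_commute)
    next
      case False thus ?thesis using main[of y x] \<open>x \<noteq> y\<close> by simp
    qed
  qed
qed

text \<open>\<open>g\<close> is a linear function plus a parabola vanishing at \<open>p\<close> and
  \<open>p + h\<close>, and \<open>G\<close> is a primitive of it. Thus \<open>b\<close> sets the
  increment of \<open>g\<close>, and \<open>c\<close> then corrects the increment of
  \<open>G\<close> without touching the end values of \<open>g\<close>. The constant 10 = 1 + 9
  bounds \<open>\<bar>b\<bar> + \<bar>c\<bar> * h\<close>.\<close>

lemma jet_cubic:
  fixes L h b c p \<alpha> \<gamma> :: real
  defines "g \<equiv> \<lambda>x. \<alpha> + b * (x - p) + c * (x - p) * (h - (x - p))"
    and "G \<equiv> \<lambda>x. \<gamma> + \<alpha> * (x - p) + b * (x - p)\<^sup>2 / 2 + c * (h * (x - p)\<^sup>2 / 2 - (x - p) ^ 3 / 3)"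
  assumes b: "\<bar>b\<bar> \<le> L" and c: "\<bar>c\<bar> * h \<le> 9 * L" and x: "p \<le> x" "x \<le> y" "y \<le> p + h"
  shows "jet (10 * L) g G x y"
proof -
  define s t where "s = x - p" and "t = y - x"
  have st: "0 \<le> s" "0 \<le> t" "s + t \<le> h" "x - p = s" "y - p = s + t" "y - x = t"
    using x by (auto simp: s_def t_def)
  have 1: "g y - g x = t * (b + c * (h - 2 * s - t))"
    unfolding g_def st by (simp add: algebra_simps)
  have "\<bar>c * (h - 2 * s - t)\<bar> \<le> \<bar>c\<bar> * h"
    unfolding abs_mult using st by (intro mult_left_mono) auto
  hence "\<bar>b + c * (h - 2 * s - t)\<bar> \<le> 10 * L" using b c by linarith
  hence A: "\<bar>g y - g x\<bar> \<le> 10 * L * t"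
    unfolding 1 abs_mult using st by (metis abs_of_nonneg mult.commute mult_right_mono)
  have 2: "G y - G x - g x * t = t\<^sup>2 * (b / 2 + c * (h / 2 - s - t / 3))"
    unfolding G_def g_def st by (simp add: field_simps power2_eq_square power3_eq_cube)
  have "\<bar>c * (h / 2 - s - t / 3)\<bar> \<le> \<bar>c\<bar> * h"
    unfolding abs_mult using st by (intro mult_left_mono) auto
  hence "\<bar>b / 2 + c * (h / 2 - s - t / 3)\<bar> \<le> 10 * L" using b c by linarith
  hence "\<bar>G y - G x - g x * t\<bar> \<le> 10 * L * t\<^sup>2"
    unfolding 2 abs_mult by (metis abs_power2 mult.commute mult_right_mono zero_le_power2)
  thus ?thesis using A st by (simp add: jet_def)
qed

lemma jet_interpolation:
  fixes g G :: "real \<Rightarrow> real"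
  assumes pq: "p < q" "jet L g G p q"
  obtains g' G' where "g' p = g p" "G' p = G p" "g' q = g q" "G' q = G q"
    "\<And>x y. p \<le> x \<Longrightarrow> x \<le> y \<Longrightarrow> y \<le> q \<Longrightarrow> jet (10 * L) g' G' x y"
proof -
  define h where "h = q - p"
  have h: "h > 0" "q = p + h" using pq by (auto simp: h_def)
  define b where "b = (g q - g p) / h"
  \<comment> \<open>The parabola \<open>x * (h - x)\<close> has integral \<open>h ^ 3 / 6\<close>
    over \<open>{0..h}\<close>, hence the 6. It has to correct at most \<open>L * h\<^sup>2\<close>
    from the jet and \<open>L * h\<^sup>2 / 2\<close> from \<open>b\<close>, which gives 9 = 6 *
    3/2.\<close>
  define c where "c = 6 * (G q - G p - g p * h - b * h\<^sup>2 / 2) / h ^ 3"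
  have j: "\<bar>g q - g p\<bar> \<le> L * h" "\<bar>G q - G p - g p * h\<bar> \<le> L * h\<^sup>2"
    using pq h by (auto simp: jet_def)
  have b: "\<bar>b\<bar> \<le> L" using j h by (simp add: b_def field_simps)
  have "\<bar>b * h\<^sup>2\<bar> \<le> L * h\<^sup>2" unfolding abs_mult using b by (simp add: mult_right_mono)
  hence "\<bar>(G q - G p - g p * h) - (b * h\<^sup>2) / 2\<bar> \<le> L * h\<^sup>2 + (L * h\<^sup>2) / 2"
    using j(2) by linarith
  hence "6 * \<bar>G q - G p - g p * h - b * h\<^sup>2 / 2\<bar> \<le> 6 * (L * h\<^sup>2 + (L * h\<^sup>2) / 2)" by simp
  hence "\<bar>6 * (G q - G p - g p * h - b * h\<^sup>2 / 2)\<bar> \<le> 9 * L * h\<^sup>2"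
    unfolding abs_mult abs_numeral by (simp add: mult.assoc)
  hence c: "\<bar>c\<bar> * h \<le> 9 * L"
    using h by (simp add: c_def field_simps power2_eq_square power3_eq_cube)
  show ?thesis
  proof (rule that)
    show "(\<lambda>x. g p + b * (x - p) + c * (x - p) * (h - (x - p))) q = g q"
      using h by (simp add: b_def)
    show "(\<lambda>x. G p + g p * (x - p) + b * (x - p)\<^sup>2 / 2 + c * (h * (x - p)\<^sup>2 / 2 - (x - p) ^ 3 / 3)) q = G q"
      using h by (simp add: c_def field_simps power2_eq_square power3_eq_cube)
  qed (use jet_cubic[OF b c, of p] h in auto)
qed

text \<open>Each gap of \<open>A\<close> is filled by the cubic interpolant of its two ends. Two
  points in different gaps are compared through \<open>hi x\<close> and \<open>lo y\<close>, the
  nearest points of \<open>A\<close> between them; these exist because \<open>A\<close> is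
  closed.\<close>

lemma jet_extension_interval:
  fixes A :: "real set"
  assumes A: "closed A" "A \<subseteq> {u..v}" "u \<in> A" "v \<in> A"
    and jet: "\<And>p q. p \<in> A \<Longrightarrow> q \<in> A \<Longrightarrow> p < q \<Longrightarrow> jet L g G p q"
  obtains g' G' where "\<And>x. x \<in> A \<Longrightarrow> g' x = g x" "\<And>x. x \<in> A \<Longrightarrow> G' x = G x"
    "\<And>x y. u \<le> x \<Longrightarrow> x < y \<Longrightarrow> y \<le> v \<Longrightarrow> jet (10 * L) g' G' x y"
proof -
  obtain g1 G1 where I: "\<And>p q. p \<in> A \<Longrightarrow> q \<in> A \<Longrightarrow> p < q \<Longrightarrow>
       g1 p q p = g p \<and> G1 p q p = G p \<and> g1 p q q = g q \<and> G1 p q q = G q \<and>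
      (\<forall>x y. p \<le> x \<longrightarrow> x \<le> y \<longrightarrow> y \<le> q \<longrightarrow> jet (10 * L) (g1 p q) (G1 p q) x y)"
  proof -
    have "\<forall>p q. \<exists>h. p \<in> A \<longrightarrow> q \<in> A \<longrightarrow> p < q \<longrightarrow>
       fst h p = g p \<and> snd h p = G p \<and> fst h q = g q \<and> snd h q = G q \<and>
      (\<forall>x y. p \<le> x \<longrightarrow> x \<le> y \<longrightarrow> y \<le> q \<longrightarrow> jet (10 * L) (fst h) (snd h) x y)"
    proof (intro allI)
      fix p q
      show "\<exists>h. p \<in> A \<longrightarrow> q \<in> A \<longrightarrow> p < q \<longrightarrow>
       fst h p = g p \<and> snd h p = G p \<and> fst h q = g q \<and> snd h q = G q \<and>
      (\<forall>x y. p \<le> x \<longrightarrow> x \<le> y \<longrightarrow> y \<le> q \<longrightarrow> jet (10 * L) (fst h) (snd h) x y)"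
      proof (cases "p \<in> A \<and> q \<in> A \<and> p < q")
        case True
        then obtain g' G' where "g' p = g p" "G' p = G p" "g' q = g q" "G' q = G q"
          "\<And>x y. p \<le> x \<Longrightarrow> x \<le> y \<Longrightarrow> y \<le> q \<Longrightarrow> jet (10 * L) g' G' x y"
          using jet jet_interpolation[of p q L g G] by blast
        thus ?thesis by (intro exI[of _ "(g', G')"]) simp
      qed auto
    qed
    then obtain H where "\<forall>p q. p \<in> A \<longrightarrow> q \<in> A \<longrightarrow> p < q \<longrightarrow>
       fst (H p q) p = g p \<and> snd (H p q) p = G p \<and> fst (H p q) q = g q \<and> snd (H p q) q = G q \<and>
      (\<forall>x y. p \<le> x \<longrightarrow> x \<le> y \<longrightarrow> y \<le> q \<longrightarrow> jet (10 * L) (fst (H p q)) (snd (H p q)) x y)"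
      by metis
    thus ?thesis by (intro that[of "\<lambda>p q. fst (H p q)" "\<lambda>p q. snd (H p q)"]) blast
  qed
  define lo where "lo x = Sup (A \<inter> {..x})" for x
  define hi where "hi x = Inf (A \<inter> {x..})" for x
  have lo: "lo x \<in> A" "lo x \<le> x" "\<And>a. a \<in> A \<Longrightarrow> a \<le> x \<Longrightarrow> a \<le> lo x" if "u \<le> x" for x
  proof -
    have ne: "A \<inter> {..x} \<noteq> {}" and bd: "bdd_above (A \<inter> {..x})" and cl: "closed (A \<inter> {..x})"
      using A that by (auto intro: closed_Int)
    show "lo x \<in> A" "lo x \<le> x" using closed_contains_Sup[OF ne bd cl] by (auto simp: lo_def)
    show "a \<le> lo x" if "a \<in> A" "a \<le> x" for a
      unfolding lo_def by (rule cSup_upper) (use that bd in auto)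
  qed
  have hi: "hi x \<in> A" "x \<le> hi x" "\<And>a. a \<in> A \<Longrightarrow> x \<le> a \<Longrightarrow> hi x \<le> a" if "x \<le> v" for x
  proof -
    have ne: "A \<inter> {x..} \<noteq> {}" and bd: "bdd_below (A \<inter> {x..})" and cl: "closed (A \<inter> {x..})"
      using A that by (auto intro: closed_Int)
    show "hi x \<in> A" "x \<le> hi x" using closed_contains_Inf[OF ne bd cl] by (auto simp: hi_def)
    show "hi x \<le> a" if "a \<in> A" "x \<le> a" for a
      unfolding hi_def by (rule cInf_lower) (use that bd in auto)
  qed
  define g' where "g' x = (if x \<in> A then g x else g1 (lo x) (hi x) x)" for x
  define G' where "G' x = (if x \<in> A then G x else G1 (lo x) (hi x) x)" for x
  have gap: "jet (10 * L) g' G' x y"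
    if "p \<in> A" "q \<in> A" "p < q" "A \<inter> {p<..<q} = {}" "p \<le> x" "x \<le> y" "y \<le> q" for p q x y
  proof -
    have "g' z = g1 p q z \<and> G' z = G1 p q z" if z: "p \<le> z" "z \<le> q" for z
    proof (cases "z \<in> A")
      case True
      hence "z = p \<or> z = q" using z \<open>A \<inter> {p<..<q} = {}\<close> by force
      thus ?thesis using I[of p q] that \<open>p \<in> A\<close> \<open>q \<in> A\<close> \<open>p < q\<close> by (auto simp: g'_def G'_def)
    next
      case False
      have z': "p < z" "z < q" using False z \<open>p \<in> A\<close> \<open>q \<in> A\<close> by (auto simp: less_le)
      have "p \<in> {u..v}" "q \<in> {u..v}" using A \<open>p \<in> A\<close> \<open>q \<in> A\<close> by auto
      hence uz: "u \<le> z" "z \<le> v" using z by auto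
      have "lo z = p"
        using lo[OF uz(1)] \<open>p \<in> A\<close> z z' \<open>A \<inter> {p<..<q} = {}\<close>
        by (metis Int_iff empty_iff greaterThanLessThan_iff le_less_trans less_le)
      moreover have "hi z = q"
        using hi[OF uz(2)] \<open>q \<in> A\<close> z z' \<open>A \<inter> {p<..<q} = {}\<close>
        by (metis Int_iff empty_iff greaterThanLessThan_iff less_le_trans less_le)
      ultimately show ?thesis using False by (simp add: g'_def G'_def)
    qed
    hence "g' x = g1 p q x" "G' x = G1 p q x" "g' y = g1 p q y" "G' y = G1 p q y"
      using that by auto
    moreover have "jet (10 * L) (g1 p q) (G1 p q) x y" using I[of p q] that by blast
    ultimately show ?thesis by (simp add: jet_def)
  qed
  have up: "jet (10 * L) g' G' x (hi x)" if "u \<le> x" "x \<le> v" for x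
  proof (cases "x \<in> A")
    case True
    hence "hi x = x" using hi[OF that(2)] by (simp add: antisym)
    thus ?thesis by (simp add: jet_refl)
  next
    case False
    have "lo x < x" "x < hi x" using lo[OF that(1)] hi[OF that(2)] False by (metis less_le)+
    moreover have "A \<inter> {lo x<..<hi x} = {}"
      using lo(3)[OF that(1)] hi(3)[OF that(2)] by (force simp: not_le)
    ultimately show ?thesis using gap[of "lo x" "hi x" x "hi x"] lo[OF that(1)] hi[OF that(2)] by auto
  qed
  have dn: "jet (10 * L) g' G' (lo x) x" if "u \<le> x" "x \<le> v" for x
  proof (cases "x \<in> A")
    case True
    hence "lo x = x" using lo[OF that(1)] by (simp add: antisym)
    thus ?thesis by (simp add: jet_refl)
  next
    case False
    have "lo x < x" "x < hi x" using lo[OF that(1)] hi[OF that(2)] False by (metis less_le)+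
    moreover have "A \<inter> {lo x<..<hi x} = {}"
      using lo(3)[OF that(1)] hi(3)[OF that(2)] by (force simp: not_le)
    ultimately show ?thesis using gap[of "lo x" "hi x" "lo x" x] lo[OF that(1)] hi[OF that(2)] by auto
  qed
  show ?thesis
  proof (rule that[of g' G'])
    fix x y assume xy: "u \<le> x" "x < y" "y \<le> v"
    show "jet (10 * L) g' G' x y"
    proof (cases "hi x \<le> y")
      case True
      have xv: "x \<le> v" and uy: "u \<le> y" using xy by auto
      have hl: "hi x \<le> lo y" using lo(3)[OF uy hi(1)[OF xv] True] .
      have "jet (10 * L) g' G' (hi x) (lo y)"
      proof (cases "hi x = lo y")
        case False
        hence j: "jet L g G (hi x) (lo y)" using jet hi(1)[OF xv] lo(1)[OF uy] hl by simp
        \<comment> \<open>No sign of \<open>L\<close> is assumed. The jet between two distinct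
          points forces \<open>L \<ge> 0\<close>, which allows the passage from \<open>L\<close> to
          \<open>10 * L\<close>.\<close>
        hence "0 \<le> L * \<bar>lo y - hi x\<bar>" using abs_ge_zero order_trans unfolding jet_def by blast
        hence "L \<ge> 0" using False by (simp add: zero_le_mult_iff)
        hence "jet (10 * L) g G (hi x) (lo y)" using j by (rule_tac jet_mono) auto
        thus ?thesis using hi(1)[OF xv] lo(1)[OF uy] by (simp add: jet_def g'_def G'_def)
      qed (simp add: jet_refl)
      with up[OF xy(1) xv] have "jet (10 * L) g' G' x (lo y)"
        using jet_trans hi(2)[OF xv] hl by blast
      thus ?thesis using dn[OF uy xy(3)] jet_trans lo(2)[OF uy] hl hi(2)[OF xv] by (meson order_trans)
    next
      case False
      have "x \<le> v" using xy by simp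
      note l = lo[OF xy(1)] and h = hi[OF \<open>x \<le> v\<close>]
      have "A \<inter> {lo x<..<hi x} = {}" using l(3) h(3) by (force simp: not_le)
      thus ?thesis using gap[of "lo x" "hi x" x y] l h xy False by auto
    qed
  qed (auto simp: g'_def G'_def)
qed

text \<open>Beyond \<open>u\<close> and \<open>v\<close> the function \<open>g'\<close> is constant
  and \<open>G'\<close> is affine with that slope, so that both differences in \<open>jet\<close>
  vanish there. The three regions are joined by \<open>jet_trans\<close> at \<open>u\<close> and
  \<open>v\<close>.\<close>

lemma jet_extension:
  fixes A :: "real set"
  assumes A: "closed A" "A \<subseteq> {u..v}" "u \<in> A" "v \<in> A" and L: "L \<ge> 0"
    and jet: "\<And>p q. p \<in> A \<Longrightarrow> q \<in> A \<Longrightarrow> p < q \<Longrightarrow> jet L g G p q"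
  obtains g' G' where "\<And>x. x \<in> A \<Longrightarrow> g' x = g x" "\<And>x. x \<in> A \<Longrightarrow> G' x = G x"
    "\<And>x y. x < y \<Longrightarrow> jet (10 * L) g' G' x y"
proof -
  obtain g1 G1 where g1: "\<And>x. x \<in> A \<Longrightarrow> g1 x = g x" "\<And>x. x \<in> A \<Longrightarrow> G1 x = G x"
    "\<And>x y. u \<le> x \<Longrightarrow> x < y \<Longrightarrow> y \<le> v \<Longrightarrow> jet (10 * L) g1 G1 x y"
    using jet_extension_interval[OF A jet] by blast
  have uv: "u \<le> v" using A by auto
  define cl where "cl x = max u (min v x)" for x
  define g' where "g' x = g1 (cl x)" for x
  define G' where "G' x = G1 (cl x) + g1 (cl x) * (x - cl x)" for x
  have l: "jet (10 * L) g' G' x y" if "x \<le> y" "y \<le> u" for x y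
  proof -
    have "cl x = u" "cl y = u" using that uv by (auto simp: cl_def)
    thus ?thesis using L by (simp add: jet_def g'_def G'_def algebra_simps)
  qed
  have r: "jet (10 * L) g' G' x y" if "x \<le> y" "v \<le> x" for x y
  proof -
    have "cl x = v" "cl y = v" using that uv by (auto simp: cl_def)
    thus ?thesis using L by (simp add: jet_def g'_def G'_def algebra_simps)
  qed
  have m: "jet (10 * L) g' G' x y" if "x \<le> y" "u \<le> x" "y \<le> v" for x y
    using g1(3)[of x y] that by (cases "x = y") (auto simp: jet_def g'_def G'_def cl_def)
  show ?thesis
  proof (rule that[of g' G'])
    fix x y :: real assume xy: "x < y"
    have ru: "jet (10 * L) g' G' x y" if "u \<le> x" "x \<le> y" for x y
    proof (cases "y \<le> v \<or> v \<le> x")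
      case False
      thus ?thesis using jet_trans[of _ _ _ x v y] m[of x v] r[of v y] that uv by auto
    qed (use r m that in auto)
    show "jet (10 * L) g' G' x y"
    proof (cases "y \<le> u \<or> u \<le> x")
      case False
      thus ?thesis using jet_trans[of _ _ _ x u y] l[of x u] ru[of u y] xy by auto
    qed (use l ru xy in auto)
  next
    fix x assume "x \<in> A"
    hence "cl x = x" using A by (auto simp: cl_def)
    thus "g' x = g x" "G' x = G x" using g1 \<open>x \<in> A\<close> by (auto simp: g'_def G'_def)
  qed
qed

section \<open>Square function of the dyadic slopes\<close>

text \<open>The index \<open>(j, k)\<close> stands for the dyadic interval of length
  \<open>2 powi j\<close> starting at \<open>k * 2 powi j\<close>. Carleson packing becomes a bound
  on \<open>desc_sum\<close> uniform in the depth \<open>n\<close>, which can be proved by induction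
  over the two children.\<close>

primrec desc_sum :: "(int \<Rightarrow> int \<Rightarrow> real) \<Rightarrow> nat \<Rightarrow> int \<Rightarrow> int \<Rightarrow> real" where
  "desc_sum c 0 j k = c j k"
| "desc_sum c (Suc n) j k =
    c j k + desc_sum c n (j - 1) (2 * k) + desc_sum c n (j - 1) (2 * k + 1)"

primrec gen_sum :: "(int \<Rightarrow> int \<Rightarrow> real) \<Rightarrow> nat \<Rightarrow> int \<Rightarrow> int \<Rightarrow> real" where
  "gen_sum c 0 j k = c j k"
| "gen_sum c (Suc n) j k = gen_sum c n (j - 1) (2 * k) + gen_sum c n (j - 1) (2 * k + 1)"

text \<open>Runs over the descendants that share the left endpoint of \<open>(j, k)\<close>: exactly
  those that touch the boundary with the left neighbour.\<close>

primrec left_sum :: "(int \<Rightarrow> int \<Rightarrow> real) \<Rightarrow> nat \<Rightarrow> int \<Rightarrow> int \<Rightarrow> real" where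
  "left_sum c 0 j k = c j k"
| "left_sum c (Suc n) j k = c j k + left_sum c n (j - 1) (2 * k)"

lemma gen_sum_eq:
  "gen_sum c n j k = (\<Sum>i\<in>{k * 2 ^ n..<(k + 1) * 2 ^ n}. c (j - int n) i)"
proof (induction n arbitrary: j k)
  case 0
  have "{k..<k + 1} = {k}" by auto
  thus ?case by simp
next
  case (Suc n)
  have "{k * 2 ^ Suc n..<(k + 1) * 2 ^ Suc n} =
      {2 * k * 2 ^ n..<(2 * k + 1) * 2 ^ n} \<union> {(2 * k + 1) * 2 ^ n..<(2 * k + 1 + 1) * 2 ^ n}"
    by (subst ivl_disj_un_two(3)) (auto simp: algebra_simps)
  hence "(\<Sum>i\<in>{k * 2 ^ Suc n..<(k + 1) * 2 ^ Suc n}. c (j - int (Suc n)) i) =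
      (\<Sum>i\<in>{2 * k * 2 ^ n..<(2 * k + 1) * 2 ^ n}. c (j - int (Suc n)) i) +
      (\<Sum>i\<in>{(2 * k + 1) * 2 ^ n..<(2 * k + 1 + 1) * 2 ^ n}. c (j - int (Suc n)) i)"
    by (simp add: sum.union_disjoint)
  thus ?case by (simp add: Suc algebra_simps)
qed

lemma desc_sum_eq: "desc_sum c n j k = (\<Sum>m\<le>n. gen_sum c m j k)"
proof (induction n arbitrary: j k)
  case (Suc n)
  have "(\<Sum>m\<le>Suc n. gen_sum c m j k) = gen_sum c 0 j k + (\<Sum>m\<le>n. gen_sum c (Suc m) j k)"
    by (rule sum.atMost_Suc_shift)
  thus ?case by (simp add: Suc sum.distrib)
qed simp

lemma desc_sum_mono:
  "(\<And>j k. c j k \<le> c' j k) \<Longrightarrow> desc_sum c n j k \<le> desc_sum c' n j k"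
  by (induction n arbitrary: j k) (auto intro!: add_mono)

lemma desc_sum_add: "desc_sum (\<lambda>j k. c j k + c' j k) n j k = desc_sum c n j k + desc_sum c' n j k"
  by (induction n arbitrary: j k) auto

lemma desc_sum_mult: "desc_sum (\<lambda>j k. a * c j k) n j k = a * desc_sum c n j k"
  by (induction n arbitrary: j k) (auto simp: algebra_simps)

lemma desc_sum_nonneg: "(\<And>j k. 0 \<le> c j k) \<Longrightarrow> 0 \<le> desc_sum c n j k"
  by (induction n arbitrary: j k) auto

lemma left_sum_nonneg: "(\<And>j k. 0 \<le> c j k) \<Longrightarrow> 0 \<le> left_sum c n j k"
  by (induction n arbitrary: j k) auto

lemma left_sum_le_desc_sum: "(\<And>j k. 0 \<le> c j k) \<Longrightarrow> left_sum c n j k \<le> desc_sum c n j k"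
  by (induction n arbitrary: j k) (auto simp: desc_sum_nonneg intro: add_increasing2)

lemma gen_sum_gen_sum: "gen_sum (gen_sum c N) m j k = gen_sum c (m + N) j k"
  by (induction m arbitrary: j k) auto

text \<open>Translating generation \<open>m\<close> by one index keeps it within generation
  \<open>m\<close> of the three adjacent intervals and is injective. So generation
  \<open>m + N\<close> is used only for \<open>m\<close>, and the bound has no factor depending on
  \<open>n\<close> or \<open>N\<close>.\<close>

lemma desc_sum_gen_sum_shift:
  assumes c: "\<And>j k. 0 \<le> c j k" and a: "a \<in> {-1, 0, 1}"
  shows "desc_sum (\<lambda>j k. gen_sum c N j (k + a)) n j k \<le>
    desc_sum c (n + N) j (k - 1) + desc_sum c (n + N) j k + desc_sum c (n + N) j (k + 1)"
proof -
  have gnn: "0 \<le> gen_sum c m j k" for m j k by (induction m arbitrary: j k) (auto simp: c)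
  have "gen_sum (\<lambda>j k. gen_sum c N j (k + a)) m j k \<le>
      gen_sum c (m + N) j (k - 1) + gen_sum c (m + N) j k + gen_sum c (m + N) j (k + 1)" for m
  proof -
    let ?I = "\<lambda>k. {k * 2 ^ m..<(k + 1) * 2 ^ m}" and ?f = "gen_sum c N (j - int m)"
    have 1: "1 \<le> (2::int) ^ m" by simp
    have "gen_sum (\<lambda>j k. gen_sum c N j (k + a)) m j k = (\<Sum>i\<in>?I k. ?f (i + a))"
      by (simp add: gen_sum_eq[of "\<lambda>j k. gen_sum c N j (k + a)"])
    also have "\<dots> = (\<Sum>i\<in>(\<lambda>i. i + a) ` ?I k. ?f i)"
      by (subst sum.reindex) (auto simp: o_def)
    also have "\<dots> \<le> (\<Sum>i\<in>?I (k - 1) \<union> ?I k \<union> ?I (k + 1). ?f i)"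
    proof (intro sum_mono2)
      show "(\<lambda>i. i + a) ` ?I k \<subseteq> ?I (k - 1) \<union> ?I k \<union> ?I (k + 1)"
        using a 1 by (auto simp: algebra_simps)
    qed (auto simp: gnn)
    also have "\<dots> \<le> (\<Sum>i\<in>?I (k - 1). ?f i) + (\<Sum>i\<in>?I k. ?f i) + (\<Sum>i\<in>?I (k + 1). ?f i)"
    proof -
      have "sum ?f (A \<union> B) \<le> sum ?f A + sum ?f B" if "finite A" "finite B" for A B
        using sum.union_inter[OF that, of ?f] sum_nonneg[of "A \<inter> B" ?f] gnn by simp
      from this[of "?I (k - 1) \<union> ?I k" "?I (k + 1)"] this[of "?I (k - 1)" "?I k"]
      show ?thesis by simp
    qed
    finally show ?thesis
      by (simp add: gen_sum_eq[of "gen_sum c N"] flip: gen_sum_gen_sum)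
  qed
  hence "desc_sum (\<lambda>j k. gen_sum c N j (k + a)) n j k \<le>
      (\<Sum>m\<le>n. gen_sum c (m + N) j (k - 1)) + (\<Sum>m\<le>n. gen_sum c (m + N) j k) +
      (\<Sum>m\<le>n. gen_sum c (m + N) j (k + 1))"
    unfolding desc_sum_eq sum.distrib[symmetric] by (intro sum_mono)
  moreover have *: "(\<Sum>m\<le>n. gen_sum c (m + N) j k) \<le> desc_sum c (n + N) j k" for k
  proof -
    have "(\<Sum>m\<le>n. gen_sum c (m + N) j k) = (\<Sum>m\<in>(\<lambda>m. m + N) ` {..n}. gen_sum c m j k)"
      by (simp add: sum.reindex)
    also have "\<dots> \<le> desc_sum c (n + N) j k"
      unfolding desc_sum_eq by (intro sum_mono2) (auto simp: gnn)
    finally show ?thesis .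
  qed
  ultimately show ?thesis using *[of "k - 1"] *[of "k + 1"] *[of k] by linarith
qed

text \<open>A finite family has bounded depth and is therefore contained in finitely many full
  generations. The condition on \<open>S\<close> is inclusion of dyadic intervals in index form, see
  \<open>dint_subset_iff\<close>.\<close>

lemma sum_le_desc_sum:
  assumes c: "\<And>j k. 0 \<le> c j k" and "finite S"
    and S: "\<And>i l. (i, l) \<in> S \<Longrightarrow> \<exists>m. i = j - int m \<and> k * 2 ^ m \<le> l \<and> l < (k + 1) * 2 ^ m"
  obtains n where "(\<Sum>(i, l)\<in>S. c i l) \<le> desc_sum c n j k"
proof -
  define n where "n = Max (insert 0 ((\<lambda>(i, l). nat (j - i)) ` S))"
  define X where "X = (SIGMA m:{..n}. {k * 2 ^ m..<(k + 1) * 2 ^ m})"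
  define h where "h = (\<lambda>(m, l). (j - int m, l :: int))"
  have inj: "inj_on h X" by (auto simp: inj_on_def h_def)
  have sub: "S \<subseteq> h ` X"
  proof
    fix q assume q: "q \<in> S"
    obtain i l where il: "q = (i, l)" by force
    then obtain m where m: "i = j - int m" "k * 2 ^ m \<le> l" "l < (k + 1) * 2 ^ m" using S q by blast
    have "nat (j - i) \<le> n" unfolding n_def
      using \<open>finite S\<close> q il by (intro Max_ge) force+
    hence "(m, l) \<in> X" using m by (auto simp: X_def)
    thus "q \<in> h ` X" using m il by (force simp: h_def)
  qed
  have "(\<Sum>(i, l)\<in>S. c i l) \<le> (\<Sum>(i, l)\<in>h ` X. c i l)"
    using sub c by (intro sum_mono2) (auto simp: X_def)
  also have "\<dots> = (\<Sum>(m, l)\<in>X. c (j - int m) l)"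
    by (subst sum.reindex[OF inj]) (simp add: h_def case_prod_beta)
  also have "\<dots> = desc_sum c n j k"
    by (simp add: X_def desc_sum_eq gen_sum_eq sum.Sigma)
  finally show ?thesis by (rule that)
qed

lemma two_powi_pred: "(2::real) powi (j - 1) = 2 powi j / 2"
  by (simp add: power_int_diff)

lemma two_powi_pos: "(0::real) < 2 powi j"
  by simp

section \<open>The martingale of dyadic slopes and its jumps\<close>

definition slope :: "(real \<Rightarrow> real) \<Rightarrow> int \<Rightarrow> int \<Rightarrow> real" where
  "slope f j k = (f ((of_int k + 1) * 2 powi j) - f (of_int k * 2 powi j)) / 2 powi j"

definition haar :: "(real \<Rightarrow> real) \<Rightarrow> int \<Rightarrow> int \<Rightarrow> real" where
  "haar f j k = (slope f (j - 1) (2 * k + 1) - slope f (j - 1) (2 * k)) / 2"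

definition jump :: "(real \<Rightarrow> real) \<Rightarrow> int \<Rightarrow> int \<Rightarrow> real" where
  "jump f j k = slope f j (k + 1) - slope f j k"

lemma slope_mult: "slope f j k * 2 powi j = f ((of_int k + 1) * 2 powi j) - f (of_int k * 2 powi j)"
  by (simp add: slope_def)

lemma slope_children: "slope f j k = (slope f (j - 1) (2 * k) + slope f (j - 1) (2 * k + 1)) / 2"
proof -
  have "of_int (2 * k) * (2::real) powi (j - 1) = of_int k * 2 powi j"
    "(of_int (2 * k) + 1) * (2::real) powi (j - 1) = (of_int (2 * k + 1)) * 2 powi (j - 1)"
    "(of_int (2 * k + 1) + 1) * (2::real) powi (j - 1) = (of_int k + 1) * 2 powi j"
    by (auto simp: two_powi_pred field_simps)
  moreover have "(c - a) / h = ((b - a) / (h / 2) + (c - b) / (h / 2)) / 2" for a b c h :: real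
    by (simp add: diff_divide_distrib)
  ultimately show ?thesis unfolding slope_def by (simp only: two_powi_pred)
qed

lemma slope_left: "slope f (j - 1) (2 * k) = slope f j k - haar f j k"
  and slope_right: "slope f (j - 1) (2 * k + 1) = slope f j k + haar f j k"
  using slope_children[of f j k] by (auto simp: haar_def field_simps)

abbreviation haar_energy :: "(real \<Rightarrow> real) \<Rightarrow> int \<Rightarrow> int \<Rightarrow> real" where
  "haar_energy f \<equiv> \<lambda>j k. 2 powi j * (haar f j k)\<^sup>2"

abbreviation jump_energy :: "(real \<Rightarrow> real) \<Rightarrow> int \<Rightarrow> int \<Rightarrow> real" where
  "jump_energy f \<equiv> \<lambda>j k. 2 powi j * (jump f j k)\<^sup>2"

lemma abs_slope_le_1:
  assumes "\<And>x y. \<bar>f x - f y\<bar> \<le> \<bar>x - y\<bar>"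
  shows "\<bar>slope f j k\<bar> \<le> 1"
  using assms[of "(of_int k + 1) * 2 powi j" "of_int k * 2 powi j"]
  by (simp add: slope_def algebra_simps)

text \<open>Orthogonality of martingale increments: the mean of the squared slopes of the two
  children is the squared slope of the parent plus the squared \<open>haar\<close>. Keeping the
  slope term on the left makes the induction close with equality.\<close>

lemma haar_energy_packing:
  assumes lip: "\<And>x y. \<bar>f x - f y\<bar> \<le> \<bar>x - y\<bar>"
  shows "desc_sum (haar_energy f) n j k + 2 powi j * (slope f j k)\<^sup>2 \<le> 2 powi j"
proof (induction n arbitrary: j k)
  have sq: "(slope f j k)\<^sup>2 \<le> 1" for j k
    using abs_slope_le_1[OF lip] by (simp add: abs_square_le_1)
  case 0
  have "2 * (slope f j k)\<^sup>2 + 2 * (haar f j k)\<^sup>2 \<le> 2"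
    using sq[of "j - 1" "2 * k"] sq[of "j - 1" "2 * k + 1"] unfolding slope_left slope_right
    by (simp add: power2_eq_square algebra_simps)
  hence "2 powi j * ((slope f j k)\<^sup>2 + (haar f j k)\<^sup>2) \<le> 2 powi j * 1"
    by (intro mult_left_mono) auto
  thus ?case by (simp add: algebra_simps)
next
  case (Suc n)
  show ?case using Suc[of "j - 1" "2 * k"] Suc[of "j - 1" "2 * k + 1"]
    unfolding slope_left slope_right two_powi_pred
    by (simp add: power2_eq_square field_simps)
qed

text \<open>The last two terms telescope: the left edge energy lost by \<open>(j, k)\<close> pays for the jump
  across the boundary of its left neighbour.\<close>

lemma jump_energy_le:
  "desc_sum (jump_energy f) n j k \<le> 4 * jump_energy f j k + 32 * desc_sum (haar_energy f) n j k
     - 12 * left_sum (haar_energy f) n j k + 12 * left_sum (haar_energy f) n j (k + 1)"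
proof (induction n arbitrary: j k)
  case 0
  show ?case by simp
next
  case (Suc n)
  define d d' D where "d = haar f j k" and "d' = haar f j (k + 1)" and "D = jump f j k"
  have D1: "jump f (j - 1) (2 * k) = 2 * d"
    by (simp add: jump_def slope_left slope_right d_def)
  \<comment> \<open>The jump from the right child of \<open>(j, k)\<close> to the left child of its
    neighbour, which are not siblings.\<close>
  have D2: "jump f (j - 1) (2 * k + 1) = D - d - d'"
  proof -
    have "slope f (j - 1) (2 * k + 1 + 1) = slope f j (k + 1) - d'"
      using slope_left[of f j "k + 1"] by (simp add: d'_def algebra_simps)
    thus ?thesis unfolding jump_def slope_right D_def d_def by simp
  qed
  \<comment> \<open>The constants of the lemma balance here. Of \<open>4 * D\<^sup>2\<close> one
    part is the jump at \<open>(j, k)\<close> itself and three are spent here. Of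
    \<open>32 * d\<^sup>2\<close>, 8 pay for the sibling jump \<open>2 * d\<close>, 12 are spent
    here, and 12 compensate the term of \<open>left_sum\<close> at \<open>(j, k)\<close>. The
    \<open>12 * d'\<^sup>2\<close> comes from \<open>left_sum\<close> at
    \<open>(j, k + 1)\<close>.\<close>
  have "2 * (D - d - d')\<^sup>2 \<le> 3 * D\<^sup>2 + 12 * d\<^sup>2 + 12 * d'\<^sup>2"
  proof -
    have "0 \<le> (D + 2 * d + 2 * d')\<^sup>2 + 6 * (d - d')\<^sup>2" by simp
    thus ?thesis by (simp add: power2_eq_square algebra_simps)
  qed
  hence "2 powi j * (2 * (D - d - d')\<^sup>2) \<le> 2 powi j * (3 * D\<^sup>2 + 12 * d\<^sup>2 + 12 * d'\<^sup>2)"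
    by (intro mult_left_mono) auto
  thus ?case
    using Suc[of "j - 1" "2 * k"] Suc[of "j - 1" "2 * k + 1"]
    unfolding D1 D2 two_powi_pred desc_sum.simps left_sum.simps
      d_def[symmetric] d'_def[symmetric] D_def[symmetric]
    by (simp add: power_mult_distrib algebra_simps)
qed

lemma jump_energy_packing:
  assumes lip: "\<And>x y. \<bar>f x - f y\<bar> \<le> \<bar>x - y\<bar>"
  shows "desc_sum (jump_energy f) n j k \<le> 60 * 2 powi j"
proof -
  have e: "desc_sum (haar_energy f) n j k \<le> 2 powi j" for k
    using haar_energy_packing[of f n j k] lip
    by (smt (verit) mult_nonneg_nonneg two_powi_pos zero_le_power2)
  have "left_sum (haar_energy f) n j (k + 1) \<le> 2 powi j"
    using left_sum_le_desc_sum[of "haar_energy f" n j "k + 1"] e[of "k + 1"] by simp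
  moreover have "0 \<le> left_sum (haar_energy f) n j k" by (intro left_sum_nonneg) simp
  moreover have "jump_energy f j k \<le> 2 powi j * 4"
  proof -
    have "\<bar>jump f j k\<bar> \<le> \<bar>2\<bar>"
      using abs_slope_le_1[of f j k] abs_slope_le_1[of f j "k + 1"] lip by (simp add: jump_def)
    hence "(jump f j k)\<^sup>2 \<le> 2\<^sup>2" by (simp only: abs_le_square_iff)
    thus ?thesis by (intro mult_left_mono) auto
  qed
  \<comment> \<open>60 = 4 * 4 + 32 + 12; the negative \<open>left_sum\<close> is dropped.\<close>
  ultimately show ?thesis using jump_energy_le[of f n j k] e[of k] by linarith
qed

section \<open>Packing of non-flat intervals\<close>

definition nbhd :: "int \<Rightarrow> int \<Rightarrow> real set" where
  "nbhd j k = {(of_int k - 1) * 2 powi j .. (of_int k + 2) * 2 powi j}"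

definition flat :: "(real \<Rightarrow> real) \<Rightarrow> real \<Rightarrow> int \<Rightarrow> int \<Rightarrow> bool" where
  "flat f \<epsilon> j k \<longleftrightarrow>
    (\<forall>x\<in>nbhd j k. \<forall>y\<in>nbhd j k. \<bar>f x - f y - slope f j k * (x - y)\<bar> \<le> \<epsilon> * 2 powi j)"

lemma nbhd_diff: "x \<in> nbhd j k \<Longrightarrow> y \<in> nbhd j k \<Longrightarrow> \<bar>x - y\<bar> \<le> 3 * 2 powi j"
  by (auto simp: nbhd_def algebra_simps abs_le_iff)

lemma nbhd_endpoints: "of_int k * 2 powi j \<in> nbhd j k" "(of_int k + 1) * 2 powi j \<in> nbhd j k"
  by (auto simp: nbhd_def)

lemma int_chain_bound:
  fixes a :: "int \<Rightarrow> real"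
  assumes "\<And>i. lo \<le> i \<Longrightarrow> i < hi \<Longrightarrow> \<bar>a (i + 1) - a i\<bar> \<le> c" and "lo \<le> i" "i \<le> i'" "i' \<le> hi"
  shows "\<bar>a i' - a i\<bar> \<le> c * of_int (i' - i)"
  using assms(3,4)
proof (induction i' rule: int_ge_induct)
  case (step i')
  have "\<bar>a (i' + 1) - a i'\<bar> \<le> c" using assms step by auto
  moreover have "\<bar>a i' - a i\<bar> \<le> c * of_int (i' - i)" using step by auto
  ultimately show ?case by (simp add: algebra_simps)
qed simp

text \<open>If all jumps \<open>N\<close> generations below are at most \<open>c\<close>, the slopes
  over the triple interval stay within \<open>\<kappa>\<close> of one slope \<open>\<mu>\<close>, so
  \<open>h x = f x - \<mu> * x\<close> moves by at most \<open>3 * \<kappa> * H\<close> along the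
  grid. Rounding two points down to the grid costs \<open>4 * w\<close> by the Lipschitz bound.
  Hence the oscillation is at most \<open>E\<close>, and replacing \<open>\<mu>\<close> by the slope
  of \<open>(j, k)\<close> itself adds at most \<open>3 * E\<close>.\<close>

lemma not_flat_imp_jump:
  assumes lip: "\<And>x y. \<bar>f x - f y\<bar> \<le> \<bar>x - y\<bar>"
    and c: "c > 0" "36 * 2 ^ N * c + 16 / 2 ^ N \<le> \<epsilon>" and nf: "\<not> flat f \<epsilon> j k"
  obtains i where "(k - 1) * 2 ^ N \<le> i" "i < (k + 2) * 2 ^ N" "\<bar>jump f (j - int N) i\<bar> > c"
proof (rule ccontr)
  assume "\<not> thesis"
  define H w where "H = (2::real) powi j" and "w = (2::real) powi (j - int N)"
  have Hw: "H = 2 ^ N * w" "H > 0" "w > 0" "w = H / 2 ^ N"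
    by (auto simp: H_def w_def power_int_diff)
  define lo hi where "lo = (k - 1) * 2 ^ N" and "hi = (k + 2) * 2 ^ N"
  have hilo: "of_int (hi - lo) = 3 * (2::real) ^ N" by (simp add: hi_def lo_def algebra_simps)
  define s where "s i = slope f (j - int N) i" for i
  have jump: "\<bar>s (i + 1) - s i\<bar> \<le> c" if "lo \<le> i" "i < hi" for i
    using that \<open>\<not> thesis\<close> \<open>\<And>i. _ \<Longrightarrow> _ \<Longrightarrow> _ \<Longrightarrow> thesis\<close>
    unfolding lo_def hi_def s_def jump_def by (meson not_le)
  define \<mu> where "\<mu> = s lo"
  define \<kappa> where "\<kappa> = 3 * 2 ^ N * c"
  have \<kappa>0: "\<kappa> \<ge> 0" using c by (simp add: \<kappa>_def)
  have s\<mu>: "\<bar>s i - \<mu>\<bar> \<le> \<kappa>" if "lo \<le> i" "i \<le> hi" for i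
  proof -
    have "\<bar>s i - s lo\<bar> \<le> c * of_int (i - lo)"
      by (rule int_chain_bound[where lo = lo and hi = hi]) (use jump that in auto)
    also have "\<dots> \<le> c * of_int (hi - lo)" using c that by (intro mult_left_mono) auto
    finally show ?thesis unfolding hilo \<mu>_def \<kappa>_def by (simp add: algebra_simps)
  qed
  define h where "h x = f x - \<mu> * x" for x
  define t where "t i = of_int i * w" for i :: int
  have \<mu>1: "\<bar>\<mu>\<bar> \<le> 1" unfolding \<mu>_def s_def by (rule abs_slope_le_1[OF lip])
  have hlip: "\<bar>h x - h y\<bar> \<le> 2 * \<bar>x - y\<bar>" for x y
  proof -
    define z where "z = \<mu> * (x - y)"
    have "\<bar>z\<bar> \<le> 1 * \<bar>x - y\<bar>" unfolding z_def abs_mult using \<mu>1 by (intro mult_right_mono) auto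
    moreover have "h x - h y = (f x - f y) - z" by (simp add: h_def z_def algebra_simps)
    ultimately show ?thesis using lip[of x y] abs_triangle_ineq4[of "f x - f y" z] by simp
  qed
  have ht1: "\<bar>h (t (i + 1)) - h (t i)\<bar> \<le> \<kappa> * w" if "lo \<le> i" "i < hi" for i
  proof -
    have "s i * w = f (t (i + 1)) - f (t i)"
      unfolding s_def w_def t_def using slope_mult[of f "j - int N" i] by simp
    moreover have "t (i + 1) = t i + w" by (simp add: t_def algebra_simps)
    ultimately have "h (t (i + 1)) - h (t i) = (s i - \<mu>) * w"
      by (simp add: h_def algebra_simps)
    thus ?thesis using s\<mu>[of i] that Hw(3) by (simp add: abs_mult)
  qed
  have ht2: "\<bar>h (t i') - h (t i)\<bar> \<le> 3 * \<kappa> * H" if "lo \<le> i" "i \<le> i'" "i' \<le> hi" for i i'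
  proof -
    have "\<bar>h (t i') - h (t i)\<bar> \<le> \<kappa> * w * of_int (i' - i)"
      by (rule int_chain_bound[where lo = lo and hi = hi]) (use ht1 that in auto)
    also have "\<dots> \<le> \<kappa> * w * of_int (hi - lo)" using that \<kappa>0 Hw(3) by (intro mult_left_mono) auto
    finally show ?thesis unfolding hilo Hw(1) by (simp add: algebra_simps)
  qed
  define E where "E = 3 * \<kappa> * H + 4 * w"
  have hE: "\<bar>h x - h y\<bar> \<le> E" if "x \<in> nbhd j k" "y \<in> nbhd j k" for x y
  proof -
    have fl: "lo \<le> \<lfloor>z / w\<rfloor> \<and> \<lfloor>z / w\<rfloor> \<le> hi \<and> \<bar>h z - h (t \<lfloor>z / w\<rfloor>)\<bar> \<le> 2 * w" if "z \<in> nbhd j k" for z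
    proof -
      have "of_int lo \<le> z / w" "z / w \<le> of_int hi"
        using that Hw(3) unfolding nbhd_def lo_def hi_def H_def[symmetric] Hw(1) by (auto simp: field_simps)
      hence "lo \<le> \<lfloor>z / w\<rfloor>" "\<lfloor>z / w\<rfloor> \<le> hi" by linarith+
      moreover have "t \<lfloor>z / w\<rfloor> \<le> z" "z \<le> t \<lfloor>z / w\<rfloor> + w"
      proof -
        have "of_int \<lfloor>z / w\<rfloor> \<le> z / w" "z / w \<le> of_int \<lfloor>z / w\<rfloor> + 1" by linarith+
        from mult_right_mono[OF this(1), of w] mult_right_mono[OF this(2), of w]
        show "t \<lfloor>z / w\<rfloor> \<le> z" "z \<le> t \<lfloor>z / w\<rfloor> + w"
          using Hw(3) by (simp_all add: t_def distrib_right)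
      qed
      ultimately show ?thesis using hlip[of z "t \<lfloor>z / w\<rfloor>"] by auto
    qed
    show ?thesis
      using fl[OF that(1)] fl[OF that(2)] ht2[of "\<lfloor>x / w\<rfloor>" "\<lfloor>y / w\<rfloor>"] ht2[of "\<lfloor>y / w\<rfloor>" "\<lfloor>x / w\<rfloor>"]
      unfolding E_def by (cases "\<lfloor>x / w\<rfloor> \<le> \<lfloor>y / w\<rfloor>") auto
  qed
  have m: "\<bar>slope f j k - \<mu>\<bar> * H \<le> E"
  proof -
    have "(slope f j k - \<mu>) * H = h ((of_int k + 1) * H) - h (of_int k * H)"
      using slope_mult[of f j k] by (simp add: h_def H_def algebra_simps)
    hence "\<bar>slope f j k - \<mu>\<bar> * H = \<bar>h ((of_int k + 1) * H) - h (of_int k * H)\<bar>"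
      using Hw(2) by (metis abs_mult abs_of_pos)
    thus ?thesis using hE[of "(of_int k + 1) * H" "of_int k * H"] nbhd_endpoints[of k j]
      by (simp add: H_def)
  qed
  have "flat f \<epsilon> j k"
    unfolding flat_def
  proof (intro ballI)
    fix x y assume xy: "x \<in> nbhd j k" "y \<in> nbhd j k"
    have "\<bar>slope f j k - \<mu>\<bar> * \<bar>x - y\<bar> \<le> \<bar>slope f j k - \<mu>\<bar> * (3 * H)"
      using nbhd_diff[OF xy] by (intro mult_left_mono) (auto simp: H_def)
    hence "\<bar>(slope f j k - \<mu>) * (x - y)\<bar> \<le> 3 * E" unfolding abs_mult using m by simp
    moreover have "f x - f y - slope f j k * (x - y) = (h x - h y) - (slope f j k - \<mu>) * (x - y)"
      by (simp add: h_def algebra_simps)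
    ultimately have "\<bar>f x - f y - slope f j k * (x - y)\<bar> \<le> 4 * E" using hE[OF xy] by linarith
    also have "4 * E = (36 * 2 ^ N * c + 16 / 2 ^ N) * H"
      unfolding E_def \<kappa>_def Hw(4) by (simp add: algebra_simps)
    also have "\<dots> \<le> \<epsilon> * H" using c Hw(2) by (intro mult_right_mono) auto
    finally show "\<bar>f x - f y - slope f j k * (x - y)\<bar> \<le> \<epsilon> * 2 powi j" by (simp add: H_def)
  qed
  thus False using nf by simp
qed

text \<open>A non-flat interval is charged to a large jump \<open>N\<close> generations below it or
  a neighbour, whose energy is at least \<open>2 powi j / K\<close>. Three shifts, each spread over
  three adjacent intervals with jump energy at most \<open>60 * 2 powi j\<close>, give the
  540.\<close>

lemma not_flat_packing:
  assumes "\<epsilon> > 0"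
  obtains C where "C \<ge> 0" "\<And>f n j k. (\<And>x y. \<bar>f x - f y\<bar> \<le> \<bar>x - y\<bar>) \<Longrightarrow>
    desc_sum (\<lambda>j k. if flat f \<epsilon> j k then 0 else 2 powi j) n j k \<le> C * 2 powi j"
proof -
  \<comment> \<open>\<open>N\<close> makes \<open>16 / 2 ^ N\<close> less than
    \<open>\<epsilon> / 2\<close>; then \<open>c\<close> makes the other term equal to
    \<open>\<epsilon> / 2\<close>.\<close>
  obtain N :: nat where N: "32 / \<epsilon> < 2 ^ N" using real_arch_pow[of 2 "32 / \<epsilon>"] by auto
  define c where "c = \<epsilon> / (72 * 2 ^ N)"
  have c: "c > 0" "36 * 2 ^ N * c + 16 / 2 ^ N \<le> \<epsilon>"
    using N assms by (auto simp: c_def field_simps)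
  define K where "K = 2 ^ N / c\<^sup>2"
  have K: "K > 0" using c by (simp add: K_def)
  show ?thesis
  proof (rule that[of "540 * K"])
    fix f :: "real \<Rightarrow> real" and n j k assume lip: "\<And>x y. \<bar>f x - f y\<bar> \<le> \<bar>x - y\<bar>"
    let ?J = "jump_energy f"
    have pos: "0 \<le> ?J j k" for j k by simp
    have gnn: "0 \<le> gen_sum ?J m j k" for m j k by (induction m arbitrary: j k) auto
    have "(if flat f \<epsilon> j k then 0 else 2 powi j) \<le>
        K * gen_sum ?J N j (k + -1) + K * gen_sum ?J N j (k + 0) + K * gen_sum ?J N j (k + 1)" for j k
    proof (cases "flat f \<epsilon> j k")
      case False
      then obtain i where i: "(k - 1) * 2 ^ N \<le> i" "i < (k + 2) * 2 ^ N" "\<bar>jump f (j - int N) i\<bar> > c"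
        using not_flat_imp_jump[OF lip c, of j k] by blast
      have le: "?J (j - int N) i \<le> gen_sum ?J N j l" if "l * 2 ^ N \<le> i" "i < (l + 1) * 2 ^ N" for l
        unfolding gen_sum_eq by (rule member_le_sum) (use that in auto)
      have "?J (j - int N) i \<le> gen_sum ?J N j (k - 1) + gen_sum ?J N j k + gen_sum ?J N j (k + 1)"
      proof -
        consider "i < k * 2 ^ N" | "k * 2 ^ N \<le> i" "i < (k + 1) * 2 ^ N" | "(k + 1) * 2 ^ N \<le> i" by linarith
        thus ?thesis
        proof cases
          case 1 thus ?thesis using le[of "k - 1"] i gnn[of N j k] gnn[of N j "k + 1"] by simp
        next
          case 2 thus ?thesis using le[of k] i gnn[of N j "k - 1"] gnn[of N j "k + 1"] by simp
        next
          case 3 thus ?thesis using le[of "k + 1"] i gnn[of N j k] gnn[of N j "k - 1"] by (simp add: add.assoc)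
        qed
      qed
      moreover have "2 powi j \<le> K * ?J (j - int N) i"
      proof -
        have "c\<^sup>2 \<le> (jump f (j - int N) i)\<^sup>2" using i c by (simp add: abs_le_square_iff[symmetric])
        hence "2 powi j * c\<^sup>2 \<le> 2 powi j * (jump f (j - int N) i)\<^sup>2" by (intro mult_left_mono) auto
        thus ?thesis using c by (simp add: K_def power_int_diff field_simps)
      qed
      ultimately show ?thesis
        using False K mult_left_mono[of "?J (j - int N) i" _ K] by (fastforce simp: distrib_left)
    qed (use K gnn in simp)
    hence "desc_sum (\<lambda>j k. if flat f \<epsilon> j k then 0 else 2 powi j) n j k \<le>
      desc_sum (\<lambda>j k. K * gen_sum ?J N j (k + -1) + K * gen_sum ?J N j (k + 0) + K * gen_sum ?J N j (k + 1)) n j k"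
      by (rule desc_sum_mono)
    also have "\<dots> = K * (desc_sum (\<lambda>j k. gen_sum ?J N j (k + -1)) n j k +
        desc_sum (\<lambda>j k. gen_sum ?J N j (k + 0)) n j k + desc_sum (\<lambda>j k. gen_sum ?J N j (k + 1)) n j k)"
      unfolding desc_sum_add desc_sum_mult by (simp add: distrib_left)
    also have "\<dots> \<le> K * (180 * 2 powi j + 180 * 2 powi j + 180 * 2 powi j)"
    proof -
      have "desc_sum (\<lambda>j k. gen_sum ?J N j (k + a)) n j k \<le> 180 * 2 powi j" if "a \<in> {-1, 0, 1}" for a
        using desc_sum_gen_sum_shift[of ?J a N n j k, OF pos that]
          jump_energy_packing[of f "n + N" j "k - 1", OF lip] jump_energy_packing[of f "n + N" j k, OF lip]
          jump_energy_packing[of f "n + N" j "k + 1", OF lip] by linarith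
      from this[of "-1"] this[of 0] this[of 1] show ?thesis
        using K by (intro mult_left_mono add_mono) simp_all
    qed
    finally show "desc_sum (\<lambda>j k. if flat f \<epsilon> j k then 0 else 2 powi j) n j k \<le> 540 * K * 2 powi j"
      by simp
  qed (use K in simp)
qed

section \<open>Stopping-time trees\<close>

text \<open>Declaring the intervals with parent \<open>(j, 0)\<close> or \<open>(j, -1)\<close> bad cuts every infinite ascending
  chain of dyadic intervals, so that each good interval has only finitely many good ancestors.
  Badness depends on the parent only, so siblings are simultaneously good or bad.\<close>

definition bad :: "(real \<Rightarrow> real) \<Rightarrow> real \<Rightarrow> int \<Rightarrow> int \<Rightarrow> bool" where
  "bad f \<epsilon> j k \<longleftrightarrow> \<not> flat f \<epsilon> (j + 1) (k div 2) \<or> k div 2 \<in> {-1, 0}"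

lemma bad_child:
  "bad f \<epsilon> (j - 1) (2 * k) \<longleftrightarrow> \<not> flat f \<epsilon> j k \<or> k \<in> {-1, 0}"
  "bad f \<epsilon> (j - 1) (2 * k + 1) \<longleftrightarrow> \<not> flat f \<epsilon> j k \<or> k \<in> {-1, 0}"
  by (auto simp: bad_def)

text \<open>The stopping rule works downwards, but the top is computed by climbing. Both tests
  concern the parent only, so siblings stop together, as (T3) demands. Whether \<open>(j, k)\<close>
  itself is bad is left to \<open>tree_root\<close> and \<open>tree\<close>.\<close>

function tree_top :: "(real \<Rightarrow> real) \<Rightarrow> real \<Rightarrow> int \<Rightarrow> int \<Rightarrow> int \<times> int" where
  "tree_top f \<epsilon> j k =
    (if bad f \<epsilon> (j + 1) (k div 2) then (j, k)
     else let R = tree_top f \<epsilon> (j + 1) (k div 2) in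
       if \<bar>slope f (j + 1) (k div 2) - slope f (fst R) (snd R)\<bar> \<le> \<epsilon> then R else (j, k))"
  by auto
termination
proof (relation "Wellfounded.measure (\<lambda>(f, \<epsilon>, j, k). nat \<bar>k\<bar>)")
  fix f \<epsilon> j k assume "\<not> bad f \<epsilon> (j + 1) (k div 2)"
  \<comment> \<open>As \<open>div\<close> rounds down, \<open>k \<mapsto> k div 2\<close> shrinks
    \<open>\<bar>k\<bar>\<close> strictly except at its fixed points 0 and -1; the second clause of
    \<open>bad\<close> stops the climb before they are reached.\<close>
  hence "k div 2 div 2 \<noteq> 0" "k div 2 div 2 \<noteq> -1" by (auto simp: bad_def)
  hence "\<bar>k div 2\<bar> < \<bar>k\<bar>" by linarith
  thus "((f, \<epsilon>, j + 1, k div 2), (f, \<epsilon>, j, k)) \<in> Wellfounded.measure (\<lambda>(f, \<epsilon>, j, k). nat \<bar>k\<bar>)" by auto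
qed auto

declare tree_top.simps [simp del]

definition tree_root :: "(real \<Rightarrow> real) \<Rightarrow> real \<Rightarrow> int \<Rightarrow> int \<Rightarrow> bool" where
  "tree_root f \<epsilon> j k \<longleftrightarrow> \<not> bad f \<epsilon> j k \<and> tree_top f \<epsilon> j k = (j, k)"

lemma tree_top_child:
  assumes "l \<in> {2 * k, 2 * k + 1}"
  shows "tree_top f \<epsilon> (j - 1) l =
    (if bad f \<epsilon> j k then (j - 1, l)
     else let R = tree_top f \<epsilon> j k in
       if \<bar>slope f j k - slope f (fst R) (snd R)\<bar> \<le> \<epsilon> then R else (j - 1, l))"
proof -
  have "l div 2 = k" using assms by auto
  thus ?thesis by (subst tree_top.simps) simp
qed

lemma tree_top_level: "j \<le> fst (tree_top f \<epsilon> j k)"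
proof (induction f \<epsilon> j k rule: tree_top.induct)
  case (1 f \<epsilon> j k)
  thus ?case by (subst tree_top.simps) (auto simp: Let_def)
qed

lemma root_tree_top:
  "\<not> bad f \<epsilon> j k \<Longrightarrow> tree_root f \<epsilon> (fst (tree_top f \<epsilon> j k)) (snd (tree_top f \<epsilon> j k))"
proof (induction f \<epsilon> j k rule: tree_top.induct)
  case (1 f \<epsilon> j k)
  show ?case
  proof (cases "tree_top f \<epsilon> j k = (j, k)")
    case True
    thus ?thesis using 1 by (simp add: tree_root_def)
  next
    case False
    hence "\<not> bad f \<epsilon> (j + 1) (k div 2)" "tree_top f \<epsilon> j k = tree_top f \<epsilon> (j + 1) (k div 2)"
      by (auto simp: tree_top.simps[of f \<epsilon> j k] Let_def split: if_splits)
    thus ?thesis using 1 by simp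
  qed
qed

text \<open>Bad siblings are charged to their parent, which has their total length. The parent is
  either non-flat or touches the origin; in the latter case at most one descendant per generation
  qualifies, and the lengths form a geometric series. So 3 = 2 + 1, where the 1 accounts for
  \<open>(j, k)\<close> itself.\<close>

lemma bad_packing:
  assumes "\<epsilon> > 0"
  obtains C where "C \<ge> 0" "\<And>f n j k. (\<And>x y. \<bar>f x - f y\<bar> \<le> \<bar>x - y\<bar>) \<Longrightarrow>
    desc_sum (\<lambda>j k. if bad f \<epsilon> j k then 2 powi j else 0) n j k \<le> C * 2 powi j"
proof -
  obtain C where C: "C \<ge> 0" "\<And>f n j k. (\<And>x y. \<bar>f x - f y\<bar> \<le> \<bar>x - y\<bar>) \<Longrightarrow>
    desc_sum (\<lambda>j k. if flat f \<epsilon> j k then 0 else 2 powi j) n j k \<le> C * 2 powi j"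
    using not_flat_packing[OF assms] by blast
  show ?thesis
  proof (rule that[of "C + 3"])
    fix f :: "real \<Rightarrow> real" and n j k assume lip: "\<And>x y. \<bar>f x - f y\<bar> \<le> \<bar>x - y\<bar>"
    define b where "b = (\<lambda>j k. if bad f \<epsilon> j k then (2::real) powi j else 0)"
    define p where "p = (\<lambda>j k. (if flat f \<epsilon> j k then 0 else (2::real) powi j))"
    define q where "q = (\<lambda>j k::int. (if k \<in> {-1, 0} then (2::real) powi j else 0))"
    have "desc_sum b n j k \<le> b j k + desc_sum (\<lambda>j k. p j k + q j k) n j k"
    proof (induction n arbitrary: j k)
      case 0
      show ?case by (simp add: p_def q_def)
    next
      case (Suc n)
      have "b (j - 1) (2 * k) + b (j - 1) (2 * k + 1) \<le> p j k + q j k"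
        by (auto simp: b_def p_def q_def bad_child two_powi_pred)
      thus ?case using Suc[of "j - 1" "2 * k"] Suc[of "j - 1" "2 * k + 1"] by simp
    qed
    moreover have "desc_sum p n j k \<le> C * 2 powi j" unfolding p_def by (rule C(2)[OF lip])
    moreover have "desc_sum q n j k \<le> (if k \<in> {-1, 0} then 2 * 2 powi j else 0)" for n j k
    proof (induction n arbitrary: j k)
      case 0
      show ?case by (simp add: q_def)
    next
      case (Suc n)
      have "2 * k = -1 \<longleftrightarrow> False" "2 * k = 0 \<longleftrightarrow> k = 0" "2 * k + 1 = -1 \<longleftrightarrow> k = -1"
        "2 * k + 1 = 0 \<longleftrightarrow> False" by presburger+
      thus ?case using Suc[of "j - 1" "2 * k"] Suc[of "j - 1" "2 * k + 1"]
        by (auto simp: q_def two_powi_pred split: if_splits)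
    qed
    moreover have "(if k \<in> {-1, 0} then 2 * 2 powi j else 0) \<le> 2 * (2::real) powi j" by simp
    moreover have "b j k \<le> 2 powi j" by (simp add: b_def)
    ultimately have "desc_sum b n j k \<le> 2 powi j + (C * 2 powi j + 2 * 2 powi j)"
      unfolding desc_sum_add by (meson add_mono order_trans)
    thus "desc_sum (\<lambda>j k. if bad f \<epsilon> j k then 2 powi j else 0) n j k \<le> (C + 3) * 2 powi j"
      unfolding b_def by (simp add: algebra_simps)
  qed (use C in simp)
qed

text \<open>Bellman function argument: along a tree the potential \<open>pot\<close> grows by at most the Haar energy,
  and where a tree is stopped because of its slope, the potential pays for the new roots.\<close>

lemma root_packing:
  assumes "\<epsilon> > 0"
  obtains C where "C \<ge> 0" "\<And>f n j k. (\<And>x y. \<bar>f x - f y\<bar> \<le> \<bar>x - y\<bar>) \<Longrightarrow>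
    desc_sum (\<lambda>j k. if tree_root f \<epsilon> j k then 2 powi j else 0) n j k \<le> C * 2 powi j"
proof -
  obtain C where C: "C \<ge> 0" "\<And>f n j k. (\<And>x y. \<bar>f x - f y\<bar> \<le> \<bar>x - y\<bar>) \<Longrightarrow>
    desc_sum (\<lambda>j k. if bad f \<epsilon> j k then 2 powi j else 0) n j k \<le> C * 2 powi j"
    using bad_packing[OF assms] by blast
  \<comment> \<open>Chosen so that a drift of the slope beyond \<open>\<epsilon>\<close> makes
    \<open>pot j k\<close> at least \<open>2 powi j\<close>, the total length of the two new
    roots.\<close>
  define A where "A = 1 / \<epsilon>\<^sup>2"
  have A: "A > 0" using assms by (simp add: A_def)
  show ?thesis
  proof (rule that[of "5 * A + C + 1"])
    fix f :: "real \<Rightarrow> real" and n j k assume lip: "\<And>x y. \<bar>f x - f y\<bar> \<le> \<bar>x - y\<bar>"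
    define b where "b = (\<lambda>j k. if bad f \<epsilon> j k then (2::real) powi j else 0)"
    define r where "r = (\<lambda>j k. if tree_root f \<epsilon> j k then (2::real) powi j else 0)"
    define top_slope where "top_slope j k = (let R = tree_top f \<epsilon> j k in slope f (fst R) (snd R))" for j k
    define pot where "pot j k =
      (if bad f \<epsilon> j k then 0 else A * (2 powi j * (slope f j k - top_slope j k)\<^sup>2))" for j k
    have pot0: "0 \<le> pot j k" for j k using A by (simp add: pot_def)
    have key: "r (j - 1) (2 * k) + r (j - 1) (2 * k + 1) + pot (j - 1) (2 * k) + pot (j - 1) (2 * k + 1)
        \<le> A * haar_energy f j k + b j k + pot j k" for j k
    proof (cases "\<not> flat f \<epsilon> j k \<or> k \<in> {-1, 0}")
      case True
      \<comment> \<open>Both children are bad, so neither is a root and neither carries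
        potential.\<close>
      thus ?thesis using A pot0[of j k] by (simp add: r_def pot_def b_def tree_root_def bad_child)
    next
      case False
      hence nb: "\<not> bad f \<epsilon> (j - 1) (2 * k)" "\<not> bad f \<epsilon> (j - 1) (2 * k + 1)" by (auto simp: bad_child)
      note top = tree_top_child[of "2 * k" k f \<epsilon> j, simplified] tree_top_child[of "2 * k + 1" k f \<epsilon> j, simplified]
      show ?thesis
      proof (cases "bad f \<epsilon> j k")
        case True
        \<comment> \<open>The good children of a bad interval are roots, with potential 0;
          \<open>b j k\<close> pays for both.\<close>
        thus ?thesis using nb A
          by (simp add: r_def pot_def b_def tree_root_def top top_slope_def two_powi_pred)
      next
        case good: False
        show ?thesis
        proof (cases "\<bar>slope f j k - top_slope j k\<bar> \<le> \<epsilon>")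
          case True
          have "tree_top f \<epsilon> (j - 1) (2 * k) = tree_top f \<epsilon> j k"
            "tree_top f \<epsilon> (j - 1) (2 * k + 1) = tree_top f \<epsilon> j k"
            using True good by (auto simp: top top_slope_def Let_def)
          moreover from this have "\<not> tree_root f \<epsilon> (j - 1) (2 * k)" "\<not> tree_root f \<epsilon> (j - 1) (2 * k + 1)"
            using tree_top_level[of j f \<epsilon> k] by (auto simp: tree_root_def)
          moreover from calculation have "top_slope (j - 1) (2 * k) = top_slope j k"
            "top_slope (j - 1) (2 * k + 1) = top_slope j k" by (auto simp: top_slope_def)
          \<comment> \<open>The children keep the reference slope, and their slopes are
            \<open>slope f j k\<close> minus and plus \<open>haar f j k\<close>. By orthogonality
            the potential grows by exactly \<open>A * haar_energy f j k\<close>.\<close>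
          ultimately show ?thesis using nb good
            unfolding r_def pot_def b_def two_powi_pred slope_left slope_right
            by (simp add: power2_eq_square field_simps)
        next
          case False
          have "tree_top f \<epsilon> (j - 1) (2 * k) = (j - 1, 2 * k)"
            "tree_top f \<epsilon> (j - 1) (2 * k + 1) = (j - 1, 2 * k + 1)"
            using False good by (auto simp: top top_slope_def Let_def)
          moreover have "2 powi j \<le> pot j k"
          proof -
            have "\<epsilon>\<^sup>2 \<le> (slope f j k - top_slope j k)\<^sup>2"
              using False assms by (simp add: abs_le_square_iff[symmetric])
            hence "2 powi j * 1 \<le> 2 powi j * (A * (slope f j k - top_slope j k)\<^sup>2)"
              using assms by (intro mult_left_mono) (auto simp: A_def field_simps)
            thus ?thesis using good by (simp add: pot_def algebra_simps)
          qed
          ultimately show ?thesis using nb good A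
            by (simp add: r_def tree_root_def b_def top_slope_def two_powi_pred add_increasing
                pot_def[of "j - 1"])
        qed
      qed
    qed
    have "desc_sum r n j k \<le>
        A * desc_sum (haar_energy f) n j k + desc_sum b n j k + pot j k + r j k" for n j k
    proof (induction n arbitrary: j k)
      case 0
      show ?case using A pot0[of j k] by (simp add: b_def)
    next
      case (Suc n)
      show ?case using Suc[of "j - 1" "2 * k"] Suc[of "j - 1" "2 * k + 1"] key[of j k]
        by (simp add: distrib_left)
    qed
    moreover have "A * desc_sum (haar_energy f) n j k \<le> A * 2 powi j"
    proof -
      have "0 \<le> 2 powi j * (slope f j k)\<^sup>2" by simp
      hence "desc_sum (haar_energy f) n j k \<le> 2 powi j"
        using haar_energy_packing[of f n j k, OF lip] by linarith
      thus ?thesis using A by (intro mult_left_mono) auto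
    qed
    moreover have "desc_sum b n j k \<le> C * 2 powi j" unfolding b_def by (rule C(2)[OF lip])
    moreover have "pot j k \<le> A * (2 powi j * 4)"
    proof -
      have "\<bar>slope f j k - top_slope j k\<bar> \<le> \<bar>2\<bar>"
        using abs_slope_le_1[of f j k, OF lip]
          abs_slope_le_1[of f "fst (tree_top f \<epsilon> j k)" "snd (tree_top f \<epsilon> j k)", OF lip]
        unfolding top_slope_def Let_def by linarith
      hence "(slope f j k - top_slope j k)\<^sup>2 \<le> 2\<^sup>2" by (simp only: abs_le_square_iff)
      thus ?thesis using A unfolding pot_def by (auto intro!: mult_left_mono)
    qed
    moreover have "r j k \<le> 2 powi j" by (simp add: r_def)
    \<comment> \<open>\<open>A\<close> comes from the Haar energy, \<open>4 * A\<close> from the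
      initial potential, and the last term is \<open>(j, k)\<close> as a possible root.\<close>
    ultimately have "desc_sum r n j k \<le> A * 2 powi j + C * 2 powi j + A * (2 powi j * 4) + 2 powi j"
      by (meson add_mono order_trans)
    thus "desc_sum (\<lambda>j k. if tree_root f \<epsilon> j k then 2 powi j else 0) n j k \<le> (5 * A + C + 1) * 2 powi j"
      unfolding r_def by (simp add: algebra_simps)
  qed (use A C in simp)
qed

lemma tree_top_parent:
  assumes "\<not> bad f \<epsilon> j k" "tree_top f \<epsilon> j k = (J, K)" "(j, k) \<noteq> (J, K)"
  shows "\<not> bad f \<epsilon> (j + 1) (k div 2)" "tree_top f \<epsilon> (j + 1) (k div 2) = (J, K)"
    "\<bar>slope f (j + 1) (k div 2) - slope f J K\<bar> \<le> \<epsilon>"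
  using assms by (auto simp: tree_top.simps[of f \<epsilon> j k] Let_def split: if_splits)

lemma nbhd_parent: "nbhd j k \<subseteq> nbhd (j + 1) (k div 2)"
proof -
  have "2 * (k div 2) \<le> k" "k \<le> 2 * (k div 2) + 1" by presburger+
  hence "2 * real_of_int (k div 2) \<le> of_int k" "of_int k \<le> 2 * real_of_int (k div 2) + 1" by linarith+
  hence "(of_int (k div 2) - 1) * 2 * 2 powi j \<le> (real_of_int k - 1) * 2 powi j"
    "(real_of_int k + 2) * 2 powi j \<le> (of_int (k div 2) + 2) * 2 * 2 powi j"
    by (intro mult_right_mono; simp)+
  thus ?thesis by (auto simp: nbhd_def power_int_add)
qed

text \<open>Not being bad means that the parent is flat, and \<open>nbhd j k\<close> lies in the
  neighbourhood of the parent. The parent's slope is \<open>\<epsilon>\<close>-close to that of the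
  top unless \<open>(j, k)\<close> is the top; then flatness of the parent itself gives
  \<open>2 * \<epsilon>\<close>. The 8 is 2 from flatness plus 3 * 2 from the slope over distance
  \<open>3 * H\<close>.\<close>

lemma tree_osc:
  assumes "\<epsilon> > 0" "\<not> bad f \<epsilon> j k" "tree_top f \<epsilon> j k = (J, K)" and xy: "x \<in> nbhd j k" "y \<in> nbhd j k"
  shows "\<bar>(f x - slope f J K * x) - (f y - slope f J K * y)\<bar> \<le> 8 * \<epsilon> * 2 powi j"
proof -
  define H where "H = (2::real) powi j"
  define m where "m = slope f (j + 1) (k div 2)"
  have fl: "\<bar>f x - f y - m * (x - y)\<bar> \<le> 2 * \<epsilon> * H" if "x \<in> nbhd j k" "y \<in> nbhd j k" for x y
  proof -
    have "\<bar>f x - f y - m * (x - y)\<bar> \<le> \<epsilon> * 2 powi (j + 1)"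
      using assms(2) that nbhd_parent[of j k] unfolding bad_def flat_def m_def by blast
    thus ?thesis by (simp add: H_def power_int_add)
  qed
  have H: "H > 0" by (simp add: H_def)
  have m: "\<bar>m - slope f J K\<bar> \<le> 2 * \<epsilon>"
  proof (cases "(j, k) = (J, K)")
    case False
    thus ?thesis using tree_top_parent(3)[OF assms(2,3)] assms(1) by (simp add: m_def)
  next
    case True
    have "\<bar>m - slope f j k\<bar> * H = \<bar>(m - slope f j k) * H\<bar>" using H by (simp add: abs_mult)
    also have "\<dots> = \<bar>f ((of_int k + 1) * H) - f (of_int k * H) - m * H\<bar>"
      using slope_mult[of f j k] by (simp add: H_def left_diff_distrib abs_minus_commute)
    also have "\<dots> \<le> 2 * \<epsilon> * H"
      using fl[OF nbhd_endpoints(2,1)] by (simp add: H_def algebra_simps)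
    finally show ?thesis using True H by simp
  qed
  have "\<bar>(m - slope f J K) * (x - y)\<bar> \<le> 2 * \<epsilon> * (3 * H)"
    unfolding abs_mult using m nbhd_diff[OF xy] assms(1) by (intro mult_mono) (auto simp: H_def)
  moreover have "(f x - slope f J K * x) - (f y - slope f J K * y) =
      (f x - f y - m * (x - y)) + (m - slope f J K) * (x - y)" by (simp add: algebra_simps)
  ultimately show ?thesis using fl[OF xy] unfolding H_def[symmetric] by linarith
qed

section \<open>Dyadic intervals and trees as sets\<close>

definition dint :: "int \<Rightarrow> int \<Rightarrow> real set" where
  "dint j k = {of_int k * 2 powi j ..< (of_int k + 1) * 2 powi j}"

lemma dyadic_intervals_eq: "dyadic_intervals = {dint j k | j k. True}"
  by (simp add: dyadic_intervals_def dint_def)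

lemma dint_bounds: "of_int k * 2 powi j < (of_int k + 1) * (2::real) powi j"
  by simp

lemma len_dint: "len (dint j k) = 2 powi j"
  unfolding len_def dint_def using dint_bounds[of k j] by (simp add: algebra_simps)

lemma double_interval_dint:
  "double_interval (dint j k) = {of_int k * 2 powi j - 2 powi j / 2 ..< of_int k * 2 powi j + 3 * 2 powi j / 2}"
proof -
  have "midpt (dint j k) = of_int k * 2 powi j + 2 powi j / 2"
    unfolding midpt_def dint_def using dint_bounds[of k j] by (simp add: field_simps)
  moreover have "a + h / 2 - h = a - h / 2" "a + h / 2 + h = a + 3 * h / 2" for a h :: real
    by simp_all
  ultimately show ?thesis by (simp only: double_interval_def len_dint)
qed

lemma two_powi_le_iff: "(2::real) powi i \<le> 2 powi j \<longleftrightarrow> i \<le> j"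
  using power_int_strict_increasing[of j i "2::real"] power_int_increasing[of i j "2::real"]
  by (cases "i \<le> j") auto

text \<open>Turns inclusion into the index ranges over which \<open>gen_sum\<close> runs, so that
  the packing bounds can be applied to sets.\<close>

lemma dint_subset_iff:
  "dint i l \<subseteq> dint j k \<longleftrightarrow> (\<exists>m. i = j - int m \<and> k * 2 ^ m \<le> l \<and> l < (k + 1) * 2 ^ m)"
proof
  assume sub: "dint i l \<subseteq> dint j k"
  define h H where "h = (2::real) powi i" and "H = (2::real) powi j"
  have hH: "h > 0" "H > 0" by (auto simp: h_def H_def)
  have 1: "of_int k * H \<le> of_int l * h" "(of_int l + 1) * h \<le> (of_int k + 1) * H"
    using sub dint_bounds[of l i] unfolding dint_def h_def H_def atLeastLessThan_subset_iff by auto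
  have "h \<le> H" using 1 by (simp add: algebra_simps)
  hence ij: "i \<le> j" unfolding h_def H_def two_powi_le_iff .
  define m where "m = nat (j - i)"
  have m: "i = j - int m" using ij by (simp add: m_def)
  have H: "H = 2 ^ m * h" by (simp add: h_def H_def m power_int_diff)
  have "of_int k * 2 ^ m \<le> (of_int l :: real)" "of_int l + 1 \<le> (of_int k + 1 :: real) * 2 ^ m"
    using 1 hH(1) unfolding H by (simp_all add: mult.assoc[symmetric])
  hence "of_int (k * 2 ^ m) \<le> (of_int l :: real)" "of_int (l + 1) \<le> (of_int ((k + 1) * 2 ^ m) :: real)"
    by simp_all
  hence "k * 2 ^ m \<le> l" "l + 1 \<le> (k + 1) * 2 ^ m" unfolding of_int_le_iff .
  thus "\<exists>m. i = j - int m \<and> k * 2 ^ m \<le> l \<and> l < (k + 1) * 2 ^ m" using m by auto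
next
  assume "\<exists>m. i = j - int m \<and> k * 2 ^ m \<le> l \<and> l < (k + 1) * 2 ^ m"
  then obtain m where m: "i = j - int m" "k * 2 ^ m \<le> l" "l + 1 \<le> (k + 1) * 2 ^ m" by auto
  define h where "h = (2::real) powi i"
  have h: "h > 0" "(2::real) powi j = 2 ^ m * h" by (auto simp: h_def m power_int_diff)
  have "of_int (k * 2 ^ m) \<le> (of_int l :: real)" "of_int (l + 1) \<le> (of_int ((k + 1) * 2 ^ m) :: real)"
    using m unfolding of_int_le_iff by auto
  hence "of_int (k * 2 ^ m) * h \<le> of_int l * h" "of_int (l + 1) * h \<le> of_int ((k + 1) * 2 ^ m) * h"
    using h by (auto intro: mult_right_mono)
  thus "dint i l \<subseteq> dint j k"
    unfolding dint_def h h_def[symmetric] atLeastLessThan_subset_iff by (simp add: mult.assoc)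
qed

lemma dint_eq_iff: "dint i l = dint j k \<longleftrightarrow> i = j \<and> l = k"
proof
  assume eq: "dint i l = dint j k"
  obtain m m' where "i = j - int m" "k * 2 ^ m \<le> l" "l < (k + 1) * 2 ^ m" "j = i - int m'"
    using dint_subset_iff[of i l j k] dint_subset_iff[of j k i l] eq by auto
  moreover from this have "m = 0" by simp
  ultimately show "i = j \<and> l = k" by simp
qed simp

lemma dint_subset_parent: "dint j k \<subseteq> dint (j + 1) (k div 2)"
  unfolding dint_subset_iff by (rule exI[of _ 1]) auto

lemma dint_subset_cases:
  assumes "dint j k \<subseteq> dint i l"
  shows "(j, k) = (i, l) \<or> dint (j + 1) (k div 2) \<subseteq> dint i l"
proof -
  obtain m where m: "j = i - int m" "l * 2 ^ m \<le> k" "k < (l + 1) * 2 ^ m"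
    using assms dint_subset_iff by auto
  show ?thesis
  proof (cases m)
    case 0
    thus ?thesis using m by simp
  next
    case (Suc n)
    have "2 * (l * 2 ^ n) \<le> k" "k < 2 * ((l + 1) * 2 ^ n)"
      using m Suc by (simp_all add: algebra_simps)
    hence "l * 2 ^ n \<le> k div 2" "k div 2 < (l + 1) * 2 ^ n" by linarith+
    thus ?thesis using m Suc unfolding dint_subset_iff by (intro disjI2 exI[of _ n]) auto
  qed
qed

lemma dyadic_children_dint:
  assumes "R \<in> dyadic_children (dint j k)"
  obtains l where "R = dint (j - 1) l" "l \<in> {2 * k, 2 * k + 1}"
proof -
  obtain i l where R: "R = dint i l" "dint i l \<subseteq> dint j k" "len (dint i l) = len (dint j k) / 2"
    using assms by (auto simp: dyadic_children_def dyadic_intervals_eq)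
  hence "(2::real) powi i = 2 powi (j - 1)" by (simp add: len_dint power_int_diff)
  hence i: "i = j - 1" unfolding order_eq_iff two_powi_le_iff .
  obtain m where "i = j - int m" "k * 2 ^ m \<le> l" "l < (k + 1) * 2 ^ m"
    using R dint_subset_iff by auto
  moreover from this i have "m = 1" by simp
  ultimately have "l \<in> {2 * k, 2 * k + 1}" by auto
  thus ?thesis using R i that by blast
qed

text \<open>An infinite sum in \<open>ennreal\<close> is controlled by its finite partial sums, each
  dominated by \<open>desc_sum\<close> at some depth. The indexing \<open>h\<close> lets the lemma
  serve both for bad intervals and for trees labelled by their tops.\<close>

lemma infsum_packing:
  fixes h :: "'a \<Rightarrow> int \<times> int"
  assumes inj: "inj_on h X" and sub: "\<And>x. x \<in> X \<Longrightarrow> dint (fst (h x)) (snd (h x)) \<subseteq> dint j k"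
    and v: "\<And>x. x \<in> X \<Longrightarrow> v x = 2 powi fst (h x)" and P: "\<And>x. x \<in> X \<Longrightarrow> P (fst (h x)) (snd (h x))"
    and pack: "\<And>n. desc_sum (\<lambda>j k. if P j k then 2 powi j else 0) n j k \<le> K"
  shows "(\<Sum>\<^sub>\<infinity>x\<in>X. ennreal (v x)) \<le> ennreal K"
proof (rule infsum_le_finite_sums)
  fix Y assume Y: "finite Y" "Y \<subseteq> X"
  let ?c = "\<lambda>j k. if P j k then (2::real) powi j else 0"
  obtain n where n: "(\<Sum>(i, l)\<in>h ` Y. ?c i l) \<le> desc_sum ?c n j k"
  proof (rule sum_le_desc_sum[of ?c "h ` Y" j k])
    fix i l assume "(i, l) \<in> h ` Y"
    then obtain x where "x \<in> X" "h x = (i, l)" using Y(2) by auto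
    hence "dint i l \<subseteq> dint j k" using sub[of x] by simp
    thus "\<exists>m. i = j - int m \<and> k * 2 ^ m \<le> l \<and> l < (k + 1) * 2 ^ m" by (simp add: dint_subset_iff)
  qed (use Y in auto)
  have "(\<Sum>x\<in>Y. v x) = (\<Sum>(i, l)\<in>h ` Y. ?c i l)"
    using inj_on_subset[OF inj Y(2)] v P Y(2)
    by (subst sum.reindex) (auto simp: case_prod_beta intro!: sum.cong)
  also have "\<dots> \<le> K" using n pack order_trans by blast
  finally have "ennreal (\<Sum>x\<in>Y. v x) \<le> ennreal K" by (rule ennreal_leI)
  moreover have "(\<Sum>x\<in>Y. ennreal (v x)) = ennreal (\<Sum>x\<in>Y. v x)"
    using v Y by (intro sum_ennreal) auto
  ultimately show "(\<Sum>x\<in>Y. ennreal (v x)) \<le> ennreal K" by simp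
qed (simp add: nonneg_summable_on_complete)

section \<open>The stopping-time trees satisfy the tree axioms\<close>

definition tree :: "(real \<Rightarrow> real) \<Rightarrow> real \<Rightarrow> int \<Rightarrow> int \<Rightarrow> real set set" where
  "tree f \<epsilon> J K = {dint j k | j k. \<not> bad f \<epsilon> j k \<and> tree_top f \<epsilon> j k = (J, K)}"

lemma dint_mem_tree:
  "dint j k \<in> tree f \<epsilon> J K \<longleftrightarrow> \<not> bad f \<epsilon> j k \<and> tree_top f \<epsilon> j k = (J, K)"
  by (auto simp: tree_def dint_eq_iff)

lemma dint_subset_tree_top: "tree_top f \<epsilon> j k = (J, K) \<Longrightarrow> dint j k \<subseteq> dint J K"
proof (induction f \<epsilon> j k arbitrary: J K rule: tree_top.induct)
  case (1 f \<epsilon> j k)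
  show ?case
  proof (cases "(j, k) = (J, K)")
    case False
    hence "\<not> bad f \<epsilon> (j + 1) (k div 2)" "tree_top f \<epsilon> (j + 1) (k div 2) = (J, K)"
      using 1(2) by (auto simp: tree_top.simps[of f \<epsilon> j k] Let_def split: if_splits)
    thus ?thesis using 1(1) dint_subset_parent[of j k] by blast
  qed simp
qed

lemma tree_upward:
  "\<not> bad f \<epsilon> j k \<Longrightarrow> tree_top f \<epsilon> j k = (J, K) \<Longrightarrow> dint j k \<subseteq> dint i l \<Longrightarrow> dint i l \<subseteq> dint J K \<Longrightarrow>
    \<not> bad f \<epsilon> i l \<and> tree_top f \<epsilon> i l = (J, K)"
proof (induction f \<epsilon> j k rule: tree_top.induct)
  case (1 f \<epsilon> j k)
  show ?case
  proof (cases "(j, k) = (i, l)")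
    case False
    hence sub: "dint (j + 1) (k div 2) \<subseteq> dint i l" using dint_subset_cases 1 by blast
    have "(j, k) \<noteq> (J, K)"
    proof
      assume "(j, k) = (J, K)"
      hence "dint j k = dint i l" using 1 by auto
      thus False using False by (simp add: dint_eq_iff)
    qed
    thus ?thesis using tree_top_parent[OF 1(2,3)] 1(1,5) sub by blast
  qed (use 1 in simp)
qed

lemma mem_tree_subset: "Q \<in> tree f \<epsilon> J K \<Longrightarrow> Q \<subseteq> dint J K"
  using dint_subset_tree_top by (fastforce simp: tree_def)

lemma top_interval_tree:
  assumes "tree_root f \<epsilon> J K"
  shows "top_interval (tree f \<epsilon> J K) = dint J K"
  unfolding top_interval_def
proof (rule Greatest_equality)
  show "dint J K \<in> tree f \<epsilon> J K" using assms by (simp add: dint_mem_tree tree_root_def)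
  show "Q \<le> dint J K" if "Q \<in> tree f \<epsilon> J K" for Q
    using that by (rule mem_tree_subset)
qed

lemma dyadic_tree_tree:
  assumes "tree_root f \<epsilon> J K"
  shows "dyadic_tree (tree f \<epsilon> J K)"
  unfolding dyadic_tree_def
proof (intro conjI ballI impI)
  show "tree f \<epsilon> J K \<subseteq> dyadic_intervals" by (auto simp: tree_def dyadic_intervals_eq)
  have "dint J K \<in> tree f \<epsilon> J K" using assms by (simp add: dint_mem_tree tree_root_def)
  thus "\<exists>Q\<in>tree f \<epsilon> J K. \<forall>R\<in>tree f \<epsilon> J K. R \<subseteq> Q"
    by (intro bexI[of _ "dint J K"] ballI mem_tree_subset)
next
  fix Q Q' assume Q: "Q \<in> tree f \<epsilon> J K" "Q' \<in> dyadic_intervals"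
    "Q \<subseteq> Q' \<and> Q' \<subseteq> top_interval (tree f \<epsilon> J K)"
  obtain j k i l where "Q = dint j k" "Q' = dint i l" "\<not> bad f \<epsilon> j k" "tree_top f \<epsilon> j k = (J, K)"
    using Q by (auto simp: tree_def dyadic_intervals_eq)
  thus "Q' \<in> tree f \<epsilon> J K"
    using Q(3) tree_upward[of f \<epsilon> j k J K i l] by (simp add: top_interval_tree[OF assms] dint_mem_tree)
next
  fix Q assume "Q \<in> tree f \<epsilon> J K"
  then obtain j k where Q: "Q = dint j k" and jk: "\<not> bad f \<epsilon> j k" "tree_top f \<epsilon> j k = (J, K)"
    by (auto simp: tree_def)
  \<comment> \<open>A child that starts its own tree has itself as \<open>tree_top\<close>; since
    its level is below \<open>J\<close>, this cannot be \<open>(J, K)\<close>.\<close>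
  have J: "j \<le> J" using tree_top_level[of j f \<epsilon> k] jk by simp
  let ?go = "(flat f \<epsilon> j k \<and> k \<notin> {-1, 0}) \<and> \<bar>slope f j k - slope f J K\<bar> \<le> \<epsilon>"
  have "dint (j - 1) l \<in> tree f \<epsilon> J K \<longleftrightarrow> ?go" if "l \<in> {2 * k, 2 * k + 1}" for l
    unfolding dint_mem_tree tree_top_child[OF that] using that jk J bad_child[of f \<epsilon> j k] by auto
  thus "dyadic_children Q \<subseteq> tree f \<epsilon> J K \<or> dyadic_children Q \<inter> tree f \<epsilon> J K = {}"
    unfolding Q by (cases ?go) (blast elim: dyadic_children_dint)+
qed

text \<open>Lengths double at each step up, so the climb from a short interval reaches a length
  between \<open>d\<close> and \<open>2 * d\<close> before leaving the tree.\<close>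

lemma tree_climb:
  "\<not> bad f \<epsilon> j k \<Longrightarrow> tree_top f \<epsilon> j k = (J, K) \<Longrightarrow> 2 powi j \<le> 2 * (d :: real) \<Longrightarrow> d \<le> 2 powi J \<Longrightarrow>
    \<exists>i l. \<not> bad f \<epsilon> i l \<and> tree_top f \<epsilon> i l = (J, K) \<and> dint j k \<subseteq> dint i l \<and>
      d \<le> 2 powi i \<and> 2 powi i \<le> 2 * d"
proof (induction f \<epsilon> j k rule: tree_top.induct)
  case (1 f \<epsilon> j k)
  show ?case
  proof (cases "d \<le> 2 powi j")
    case False
    hence "(j, k) \<noteq> (J, K)" using 1 by auto
    note par = tree_top_parent[OF 1(2,3) this]
    have "(2::real) powi (j + 1) \<le> 2 * d" using False by (simp add: power_int_add)
    from 1(1)[OF par(1) par(1,2) this 1(5)] show ?thesis using dint_subset_parent[of j k] by blast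
  qed (use 1 in blast)
qed

section \<open>Approximation on trees\<close>

lemma tame_on_imp_lipschitz:
  assumes "tame_on 1 UNIV \<phi>"
  shows "\<bar>fst (\<phi> x) - fst (\<phi> y)\<bar> \<le> \<bar>x - y\<bar>"
proof (cases "x = y")
  case False
  hence "\<bar>(snd (\<phi> x) - snd (\<phi> y)) / (x - y) - fst (\<phi> x)\<bar> +
      \<bar>(snd (\<phi> x) - snd (\<phi> y)) / (x - y) - fst (\<phi> y)\<bar> \<le> 1 * \<bar>x - y\<bar>"
    using assms by (auto simp: tame_on_def)
  moreover have "\<bar>a - u\<bar> + \<bar>a - v\<bar> \<le> 1 * d \<Longrightarrow> \<bar>u - v\<bar> \<le> d" for a u v d :: real
    by linarith
  ultimately show ?thesis by blast
qed simp

lemma tame_on_imp_deriv: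
  assumes "tame_on 1 UNIV \<phi>"
  shows "((\<lambda>t. snd (\<phi> t)) has_real_derivative fst (\<phi> x)) (at x)"
  unfolding has_field_derivative_iff
proof (rule LIM_zero_cancel, rule Lim_null_comparison)
  show "\<forall>\<^sub>F y in at x. norm ((snd (\<phi> y) - snd (\<phi> x)) / (y - x) - fst (\<phi> x)) \<le> \<bar>y - x\<bar>"
    unfolding eventually_at_filter
  proof (intro always_eventually allI impI)
    fix y assume "y \<noteq> x"
    hence "\<bar>(snd (\<phi> y) - snd (\<phi> x)) / (y - x) - fst (\<phi> y)\<bar> +
        \<bar>(snd (\<phi> y) - snd (\<phi> x)) / (y - x) - fst (\<phi> x)\<bar> \<le> 1 * \<bar>y - x\<bar>"
      using assms by (auto simp: tame_on_def)
    thus "norm ((snd (\<phi> y) - snd (\<phi> x)) / (y - x) - fst (\<phi> x)) \<le> \<bar>y - x\<bar>" by simp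
  qed
  show "((\<lambda>y. \<bar>y - x\<bar>) \<longlongrightarrow> 0) (at x)"
    by (rule tendsto_eq_intros refl | simp)+
qed

lemma jet_of_oscillation:
  fixes g G :: "real \<Rightarrow> real"
  assumes der: "\<And>x. (G has_real_derivative g x) (at x)"
    and osc: "\<And>z. z \<in> closed_segment p q \<Longrightarrow> \<bar>g z - g p\<bar> \<le> M"
  shows "\<bar>G q - G p - g p * (q - p)\<bar> \<le> M * \<bar>q - p\<bar>"
proof -
  have "\<exists>z\<in>closed_segment p q. G q - G p = g z * (q - p)"
  proof -
    consider "p < q" | "q < p" | "p = q" by linarith
    thus ?thesis
    proof cases
      case 1
      obtain z where "p < z" "z < q" "G q - G p = (q - p) * g z"
        using MVT2[OF 1, of G g] der by blast
      thus ?thesis by (intro bexI[of _ z]) (auto simp: closed_segment_eq_real_ivl)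
    next
      case 2
      obtain z where "q < z" "z < p" "G p - G q = (p - q) * g z"
        using MVT2[OF 2, of G g] der by blast
      thus ?thesis by (intro bexI[of _ z]) (auto simp: closed_segment_eq_real_ivl algebra_simps)
    qed auto
  qed
  then obtain z where z: "z \<in> closed_segment p q" "G q - G p = g z * (q - p)" by blast
  have "G q - G p - g p * (q - p) = (g z - g p) * (q - p)" using z by (simp add: algebra_simps)
  thus ?thesis using osc[OF z(1)] by (simp add: abs_mult mult_right_mono)
qed

text \<open>Carries the jet bounds from the endpoints of the intervals of a tree to their closure,
  since the gaps are those of a closed set.\<close>

lemma closed_jet:
  assumes "continuous_on UNIV g" "continuous_on UNIV G"
  shows "closed {z. jet L g G (fst z) (snd z)}"
proof -
  have c: "continuous_on UNIV (\<lambda>z::real \<times> real. h (fst z))" "continuous_on UNIV (\<lambda>z::real \<times> real. h (snd z))"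
    if "continuous_on UNIV h" for h :: "real \<Rightarrow> real"
    by (auto intro!: continuous_on_compose2[OF that] continuous_intros)
  show ?thesis
    unfolding jet_def
    by (intro closed_Collect_conj closed_Collect_le continuous_intros c assms)
qed

text \<open>The jet is only prescribed at the endpoints of the intervals of the tree. Two such endpoints
  at distance \<open>d\<close> lie in the neighbourhood of one interval of the tree of length comparable to \<open>d\<close>,
  since they are integer multiples of the smaller of the two lengths.\<close>

lemma tree_approximation:
  fixes f F :: "real \<Rightarrow> real"
  assumes lip: "\<And>x y. \<bar>f x - f y\<bar> \<le> \<bar>x - y\<bar>" and der: "\<And>x. (F has_real_derivative f x) (at x)"
    and \<eta>: "0 < \<eta>" "\<eta> < 1" and \<epsilon>: "\<epsilon> = \<eta>\<^sup>2 / 1000" and root: "tree_root f \<epsilon> J K"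
  shows "\<exists>\<L> \<psi>. L_tame_linear 2 \<L> \<and> tame_on \<eta> UNIV \<psi> \<and>
    (\<forall>Q\<in>tree f \<epsilon> J K. \<forall>s\<in>double_interval Q. d_par (f s, F s) (\<psi> s + \<L> s) \<le> \<eta> * len Q)"
proof -
  have \<epsilon>0: "\<epsilon> > 0" unfolding \<epsilon> using \<eta> by simp
  define a where "a = slope f J K"
  have a: "\<bar>a\<bar> \<le> 1" unfolding a_def by (rule abs_slope_le_1[OF lip])
  define g where "g x = f x - a * x" for x
  define G where "G x = F x - a * x\<^sup>2 / 2" for x
  have derG: "(G has_real_derivative g x) (at x)" for x
    unfolding G_def g_def by (auto intro!: derivative_eq_intros der)
  have contG: "continuous_on UNIV G"
    using derG DERIV_isCont continuous_at_imp_continuous_on by blast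
  have "1-lipschitz_on UNIV f" using lip by (intro lipschitz_onI) (auto simp: dist_real_def)
  hence contg: "continuous_on UNIV g"
    unfolding g_def by (intro continuous_intros lipschitz_on_continuous_on)
  let ?in = "\<lambda>j k. \<not> bad f \<epsilon> j k \<and> tree_top f \<epsilon> j k = (J, K)"
  have osc: "\<bar>g q - g p\<bar> \<le> 8 * \<epsilon> * 2 powi j"
    and oscG: "\<bar>G q - G p - g p * (q - p)\<bar> \<le> 8 * \<epsilon> * 2 powi j * \<bar>q - p\<bar>"
    if "?in j k" "p \<in> nbhd j k" "q \<in> nbhd j k" for j k p q
  proof -
    have *: "\<bar>g z - g p\<bar> \<le> 8 * \<epsilon> * 2 powi j" if "z \<in> nbhd j k" for z
      unfolding g_def a_def using tree_osc[OF \<epsilon>0, of f j k J K z p] \<open>?in j k\<close> \<open>p \<in> nbhd j k\<close> that by blast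
    show "\<bar>g q - g p\<bar> \<le> 8 * \<epsilon> * 2 powi j" using * that by blast
    have "closed_segment p q \<subseteq> nbhd j k"
      using that by (intro closed_segment_subset) (auto simp: nbhd_def)
    thus "\<bar>G q - G p - g p * (q - p)\<bar> \<le> 8 * \<epsilon> * 2 powi j * \<bar>q - p\<bar>"
      using * by (intro jet_of_oscillation derG) blast
  qed
  define A0 :: "real set" where "A0 = {of_int l * 2 powi j | j k l. ?in j k \<and> l \<in> {k, k + 1}}"
  let ?u = "of_int K * (2::real) powi J" and ?v = "(of_int K + 1) * (2::real) powi J"
  have cl: "of_int l * (2::real) powi i \<in> {of_int k * 2 powi j .. (of_int k + 1) * 2 powi j}"
    if "dint i l' \<subseteq> dint j k" "l \<in> {l', l' + 1}" for i l l' j k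
  proof -
    have 1: "of_int k * 2 powi j \<le> of_int l' * (2::real) powi i"
      "(of_int l' + 1) * 2 powi i \<le> (of_int k + 1) * (2::real) powi j"
      using that(1) dint_bounds[of l' i] unfolding dint_def atLeastLessThan_subset_iff by auto
    have "of_int l = (of_int l' :: real) \<or> of_int l = (of_int l' + 1 :: real)" using that(2) by auto
    thus ?thesis
      unfolding atLeastAtMost_iff using 1 dint_bounds[of l' i] by (elim disjE; simp only:; linarith)
  qed
  have A0sub: "A0 \<subseteq> {?u..?v}"
  proof
    fix x assume "x \<in> A0"
    then obtain j k l where "x = of_int l * 2 powi j" "tree_top f \<epsilon> j k = (J, K)" "l \<in> {k, k + 1}"
      by (auto simp: A0_def)
    thus "x \<in> {?u..?v}" using cl[OF dint_subset_tree_top] by blast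
  qed
  have inJ: "?in J K" using root by (simp add: tree_root_def)
  have uA0: "of_int k * 2 powi j \<in> A0" "(of_int k + 1) * 2 powi j \<in> A0" if "?in j k" for j k
  proof -
    have "of_int l * 2 powi j \<in> A0" if "l \<in> {k, k + 1}" for l
      using that \<open>?in j k\<close> unfolding A0_def by blast
    from this[of k] this[of "k + 1"]
    show "of_int k * 2 powi j \<in> A0" "(of_int k + 1) * 2 powi j \<in> A0" by simp_all
  qed
  have jet0: "jet (16 * \<epsilon>) g G p q" if pq: "p \<in> A0" "q \<in> A0" for p q
  proof (cases "p = q")
    case False
    define d where "d = \<bar>q - p\<bar>"
    have d0: "d > 0" using False by (simp add: d_def)
    have dJ: "d \<le> 2 powi J"
    proof -
      have "p \<in> {?u..?v}" "q \<in> {?u..?v}" using that A0sub by auto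
      thus ?thesis by (auto simp: d_def algebra_simps)
    qed
    obtain j1 k1 l1 where p: "p = of_int l1 * 2 powi j1" "?in j1 k1" "l1 \<in> {k1, k1 + 1}"
      using pq unfolding A0_def by blast
    obtain j2 k2 l2 where q: "q = of_int l2 * 2 powi j2" "?in j2 k2" "l2 \<in> {k2, k2 + 1}"
      using pq unfolding A0_def by blast
    have sep: "2 powi min j1 j2 \<le> d"
    proof -
      define m where "m = min j1 j2"
      have pm: "of_int l * (2::real) powi j = of_int (l * 2 ^ nat (j - m)) * 2 powi m" if "m \<le> j" for l j
        using that power_int_add[of "2::real" "j - m" m] by (simp add: power_int_nonneg_exp)
      define n where "n = l2 * 2 ^ nat (j2 - m) - l1 * 2 ^ nat (j1 - m)"
      have "q - p = of_int n * 2 powi m"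
        unfolding p q pm[of j1, OF min.cobounded1[of j1 j2, folded m_def]]
          pm[of j2, OF min.cobounded2[of j1 j2, folded m_def]] n_def by (simp add: left_diff_distrib)
      hence dn: "d = \<bar>of_int n\<bar> * 2 powi m" by (simp add: d_def abs_mult)
      hence "n \<noteq> 0" using d0 by auto
      hence "1 \<le> \<bar>real_of_int n\<bar>" by linarith
      thus ?thesis unfolding dn m_def[symmetric] by simp
    qed
    \<comment> \<open>The climb starts from the shorter of the two intervals, whose length is at
      most \<open>d\<close>. One of the points then lies in the closed interval
      \<open>(i, l)\<close>, and the other is within \<open>d \<le> 2 powi i\<close>, hence in its
      triple.\<close>
    obtain z i l where il: "?in i l" "d \<le> 2 powi i" "2 powi i \<le> 2 * d" and z: "z \<in> {p, q}"
      "z \<in> {of_int l * 2 powi i .. (of_int l + 1) * 2 powi i}"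
    proof (cases "j1 \<le> j2")
      case True
      hence "2 powi j1 \<le> 2 * d" using sep d0 by simp
      then obtain i l where "?in i l" "d \<le> 2 powi i" "2 powi i \<le> 2 * d" "dint j1 k1 \<subseteq> dint i l"
        using tree_climb[of f \<epsilon> j1 k1 J K d] p dJ by blast
      thus ?thesis using that[of i l p] cl[of j1 k1 i l l1] p by blast
    next
      case False
      hence "2 powi j2 \<le> 2 * d" using sep d0 by simp
      then obtain i l where "?in i l" "d \<le> 2 powi i" "2 powi i \<le> 2 * d" "dint j2 k2 \<subseteq> dint i l"
        using tree_climb[of f \<epsilon> j2 k2 J K d] q dJ by blast
      thus ?thesis using that[of i l q] cl[of j2 k2 i l l2] q by blast
    qed
    have "p \<in> nbhd i l" "q \<in> nbhd i l"
      using z il(2) unfolding nbhd_def d_def by (auto simp: algebra_simps)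
    note o = osc[OF il(1) this] oscG[OF il(1) this]
    have "8 * \<epsilon> * 2 powi i \<le> 16 * \<epsilon> * d" using il(3) \<epsilon>0 by simp
    moreover from this have "8 * \<epsilon> * 2 powi i * d \<le> 16 * \<epsilon> * d * d"
      using d0 by (intro mult_right_mono) auto
    moreover have "(q - p)\<^sup>2 = d * d" by (simp add: d_def power2_eq_square)
    ultimately show ?thesis using o
      unfolding jet_def d_def[symmetric] by (auto simp: mult.assoc intro: order_trans)
  qed (simp add: jet_refl)
  define A where "A = closure A0"
  have A: "closed A" "A \<subseteq> {?u..?v}" "?u \<in> A" "?v \<in> A"
    using closure_minimal[OF A0sub closed_atLeastAtMost] uA0[OF inJ] closure_subset[of A0]
    unfolding A_def by blast+
  have jetA: "jet (16 * \<epsilon>) g G p q" if "p \<in> A" "q \<in> A" for p q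
  proof -
    have "A \<times> A \<subseteq> {z. jet (16 * \<epsilon>) g G (fst z) (snd z)}"
      unfolding A_def closure_Times[symmetric]
      by (intro closure_minimal closed_jet contg contG) (auto simp: jet0)
    thus ?thesis using that by auto
  qed
  obtain g' G' where ext: "\<And>x. x \<in> A \<Longrightarrow> g' x = g x" "\<And>x. x \<in> A \<Longrightarrow> G' x = G x"
    "\<And>x y. x < y \<Longrightarrow> jet (10 * (16 * \<epsilon>)) g' G' x y"
    using jet_extension[OF A, of "16 * \<epsilon>" g G] jetA \<epsilon>0 by (auto simp del: mult.assoc)
  have \<epsilon>\<eta>: "1000 * \<epsilon> \<le> \<eta>" using \<eta> unfolding \<epsilon> by (simp add: power2_eq_square)
  define \<psi> where "\<psi> x = (g' x, G' x)" for x
  define \<L> where "\<L> x = (a * x, a * x\<^sup>2 / 2)" for x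
  have "jet (\<eta> / 3) g' G' x y" if "x < y" for x y
    using ext(3)[OF that] by (rule jet_mono) (use \<epsilon>\<eta> \<epsilon>0 in simp)
  hence "tame_on \<eta> UNIV \<psi>" using jet_imp_tame_on[of "\<eta> / 3" g' G' UNIV] by (simp add: \<psi>_def[abs_def])
  moreover have "L_tame_linear 2 \<L>"
    unfolding L_tame_linear_def tame_linear_def
  proof (intro conjI allI)
    show "linear (\<lambda>s. fst (\<L> s))" by (auto simp: \<L>_def linear_iff algebra_simps)
    show "((\<lambda>t. snd (\<L> t)) has_real_derivative fst (\<L> s)) (at s)" for s
      by (auto simp: \<L>_def intro!: derivative_eq_intros)
    have "\<bar>a * x - a * y\<bar> \<le> 2 * \<bar>x - y\<bar>" for x y
      using a by (simp add: abs_mult mult_right_mono flip: right_diff_distrib)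
    thus "2-lipschitz_on UNIV (\<lambda>s. fst (\<L> s))"
      by (intro lipschitz_onI) (auto simp: \<L>_def dist_real_def)
  qed
  moreover have "d_par (f s, F s) (\<psi> s + \<L> s) \<le> \<eta> * len Q"
    if Q: "Q \<in> tree f \<epsilon> J K" and s: "s \<in> double_interval Q" for Q s
  proof -
    obtain j k where jk: "Q = dint j k" "?in j k" using Q by (auto simp: tree_def)
    define h where "h = (2::real) powi j"
    have h: "h > 0" by (simp add: h_def)
    define u where "u = of_int k * h"
    have uA: "u \<in> A" using uA0(1)[OF jk(2)] closure_subset[of A0] by (auto simp: A_def u_def h_def)
    have su: "u - h / 2 \<le> s" "s < u + 3 * h / 2"
      using s unfolding jk double_interval_dint by (auto simp: u_def h_def)
    hence sh: "\<bar>s - u\<bar> \<le> 3 / 2 * h" by linarith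
    have nb: "u \<in> nbhd j k" "s \<in> nbhd j k"
      using su h by (auto simp: nbhd_def u_def h_def[symmetric] algebra_simps)
    \<comment> \<open>The extension gives 160 for increasing pairs; 320 covers \<open>s\<close> to
      the left of \<open>u\<close>.\<close>
    have "jet (320 * \<epsilon>) g' G' u s"
    proof -
      consider "u < s" | "s < u" | "u = s" by linarith
      thus ?thesis
      proof cases
        case 1
        thus ?thesis using ext(3)[OF 1] by (rule_tac jet_mono) (use \<epsilon>0 in auto)
      next
        case 2
        thus ?thesis using jet_sym[OF ext(3)[OF 2]] by simp
      qed (simp add: jet_refl)
    qed
    hence j: "\<bar>g' s - g u\<bar> \<le> 320 * \<epsilon> * \<bar>s - u\<bar>" "\<bar>G' s - G u - g u * (s - u)\<bar> \<le> 320 * \<epsilon> * (s - u)\<^sup>2"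
      unfolding jet_def ext(1,2)[OF uA] by auto
    note o = osc[OF jk(2) nb, folded h_def] oscG[OF jk(2) nb, folded h_def]
    have "320 * \<epsilon> * \<bar>s - u\<bar> \<le> 320 * \<epsilon> * (3 / 2 * h)" using sh \<epsilon>0 by (intro mult_left_mono) auto
    \<comment> \<open>488 = 8 + 320 * 3/2: \<open>g'\<close> and \<open>g\<close> agree at
      \<open>u\<close>, and both vary little from \<open>u\<close> to \<open>s\<close>.\<close>
    hence "\<bar>g s - g' s\<bar> \<le> 488 * (\<epsilon> * h)" using o(1) j(1) by simp
    also have "\<dots> \<le> (1000 * \<epsilon>) * h" using \<epsilon>0 h by simp
    also have "\<dots> \<le> \<eta> * h" using \<epsilon>\<eta> h by (intro mult_right_mono) auto
    finally have 1: "\<bar>g s - g' s\<bar> \<le> \<eta> * h" .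
    have "(s - u)\<^sup>2 \<le> (3 / 2 * h)\<^sup>2" using sh h by (simp add: abs_le_square_iff[symmetric])
    hence "320 * \<epsilon> * (s - u)\<^sup>2 \<le> 320 * \<epsilon> * (3 / 2 * h)\<^sup>2" using \<epsilon>0 by (intro mult_left_mono) auto
    moreover have "8 * \<epsilon> * h * \<bar>s - u\<bar> \<le> 8 * \<epsilon> * h * (3 / 2 * h)"
      using sh h \<epsilon>0 by (intro mult_left_mono) auto
    \<comment> \<open>732 = 8 * 3/2 + 320 * 9/4, comparing \<open>G\<close> and \<open>G'\<close>
      with their common first-order expansion at \<open>u\<close>.\<close>
    ultimately have "\<bar>G s - G' s\<bar> \<le> 732 * (\<epsilon> * h\<^sup>2)"
      using o(2) j(2) by (simp add: power2_eq_square)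
    also have "\<dots> \<le> 1000 * \<epsilon> * h\<^sup>2" using \<epsilon>0 by simp
    also have "\<dots> = (\<eta> * h)\<^sup>2" by (simp add: \<epsilon> power_mult_distrib)
    finally have "sqrt \<bar>G s - G' s\<bar> \<le> \<eta> * h" using \<eta> h by (simp add: real_le_lsqrt)
    thus ?thesis using 1
      by (simp add: d_par_def \<psi>_def \<L>_def jk len_dint g_def G_def h_def algebra_simps)
  qed
  ultimately show ?thesis by blast
qed

lemma tree_disjoint: "tree f \<epsilon> J K \<inter> tree f \<epsilon> J' K' \<noteq> {} \<Longrightarrow> (J, K) = (J', K')"
  by (auto simp: tree_def dint_eq_iff)

theorem theorem3p15:
  "\<forall>\<eta>::real. 0 < \<eta> \<and> \<eta> < 1 \<longrightarrow>
    (\<exists>C::real. C \<ge> 1 \<and>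
      (\<forall>\<phi> :: real \<Rightarrow> real \<times> real. tame_on 1 UNIV \<phi> \<longrightarrow>
        (\<exists>\<B> \<G> :: real set set.
          \<B> \<union> \<G> = dyadic_intervals \<and> \<B> \<inter> \<G> = {} \<and>
          (\<forall>Q0\<in>dyadic_intervals.
            (\<Sum>\<^sub>\<infinity>Q\<in>{Q\<in>\<B>. Q \<subseteq> Q0}. ennreal (len Q)) \<le> ennreal (C * len Q0)) \<and>
          (\<exists>\<F> :: real set set set.
            (\<forall>\<T>\<in>\<F>. dyadic_tree \<T>) \<and>
            disjoint \<F> \<and>
            \<G> = \<Union>\<F> \<and>
            (\<forall>Q0\<in>dyadic_intervals.
              (\<Sum>\<^sub>\<infinity>\<T>\<in>{\<T>\<in>\<F>. top_interval \<T> \<subseteq> Q0}. ennreal (len (top_interval \<T>)))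
                \<le> ennreal (C * len Q0)) \<and>
            (\<forall>\<T>\<in>\<F>. \<exists>\<L> \<psi> :: real \<Rightarrow> real \<times> real.
              L_tame_linear 2 \<L> \<and> tame_on \<eta> UNIV \<psi> \<and>
              (\<forall>Q\<in>\<T>. \<forall>s\<in>double_interval Q.
                d_par (\<phi> s) (\<psi> s + \<L> s) \<le> \<eta> * len Q))))))"
proof (intro allI impI)
  fix \<eta> :: real assume \<eta>: "0 < \<eta> \<and> \<eta> < 1"
  define \<epsilon> where "\<epsilon> = \<eta>\<^sup>2 / 1000"
  have \<epsilon>0: "\<epsilon> > 0" using \<eta> by (simp add: \<epsilon>_def)
  obtain C1 where C1: "C1 \<ge> 0" "\<And>f n j k. (\<And>x y. \<bar>f x - f y\<bar> \<le> \<bar>x - y\<bar>) \<Longrightarrow>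
      desc_sum (\<lambda>j k. if bad f \<epsilon> j k then 2 powi j else 0) n j k \<le> C1 * 2 powi j"
    using bad_packing[OF \<epsilon>0] by blast
  obtain C2 where C2: "C2 \<ge> 0" "\<And>f n j k. (\<And>x y. \<bar>f x - f y\<bar> \<le> \<bar>x - y\<bar>) \<Longrightarrow>
      desc_sum (\<lambda>j k. if tree_root f \<epsilon> j k then 2 powi j else 0) n j k \<le> C2 * 2 powi j"
    using root_packing[OF \<epsilon>0] by blast
  define C where "C = C1 + C2 + 1"
  have C: "C \<ge> 1" "C1 * 2 powi j \<le> C * 2 powi j" "C2 * 2 powi j \<le> C * 2 powi j" for j
    using C1(1) C2(1) by (auto simp: C_def intro!: mult_right_mono)
  show "\<exists>C::real. C \<ge> 1 \<and>
      (\<forall>\<phi> :: real \<Rightarrow> real \<times> real. tame_on 1 UNIV \<phi> \<longrightarrow>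
        (\<exists>\<B> \<G> :: real set set.
          \<B> \<union> \<G> = dyadic_intervals \<and> \<B> \<inter> \<G> = {} \<and>
          (\<forall>Q0\<in>dyadic_intervals.
            (\<Sum>\<^sub>\<infinity>Q\<in>{Q\<in>\<B>. Q \<subseteq> Q0}. ennreal (len Q)) \<le> ennreal (C * len Q0)) \<and>
          (\<exists>\<F> :: real set set set.
            (\<forall>\<T>\<in>\<F>. dyadic_tree \<T>) \<and>
            disjoint \<F> \<and>
            \<G> = \<Union>\<F> \<and>
            (\<forall>Q0\<in>dyadic_intervals.
              (\<Sum>\<^sub>\<infinity>\<T>\<in>{\<T>\<in>\<F>. top_interval \<T> \<subseteq> Q0}. ennreal (len (top_interval \<T>)))
                \<le> ennreal (C * len Q0)) \<and>
            (\<forall>\<T>\<in>\<F>. \<exists>\<L> \<psi> :: real \<Rightarrow> real \<times> real.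
              L_tame_linear 2 \<L> \<and> tame_on \<eta> UNIV \<psi> \<and>
              (\<forall>Q\<in>\<T>. \<forall>s\<in>double_interval Q.
                d_par (\<phi> s) (\<psi> s + \<L> s) \<le> \<eta> * len Q)))))"
  proof (rule exI[of _ C], intro conjI allI impI)
    fix \<phi> :: "real \<Rightarrow> real \<times> real" assume \<phi>: "tame_on 1 UNIV \<phi>"
    define f where "f x = fst (\<phi> x)" for x
    have lip: "\<bar>f x - f y\<bar> \<le> \<bar>x - y\<bar>" for x y
      unfolding f_def by (rule tame_on_imp_lipschitz[OF \<phi>])
    define \<B> where "\<B> = {dint j k | j k. bad f \<epsilon> j k}"
    define \<G> where "\<G> = {dint j k | j k. \<not> bad f \<epsilon> j k}"
    define \<F> where "\<F> = {tree f \<epsilon> J K | J K. tree_root f \<epsilon> J K}"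
    define ix where "ix Q = (THE p. Q = dint (fst p) (snd p))" for Q
    have ix: "ix (dint j k) = (j, k)" for j k
      unfolding ix_def by (rule the_equality) (auto simp: dint_eq_iff)
    have "\<B> \<union> \<G> = dyadic_intervals" "\<B> \<inter> \<G> = {}"
      by (auto simp: \<B>_def \<G>_def dyadic_intervals_eq dint_eq_iff)
    moreover have "\<forall>Q0\<in>dyadic_intervals.
        (\<Sum>\<^sub>\<infinity>Q\<in>{Q\<in>\<B>. Q \<subseteq> Q0}. ennreal (len Q)) \<le> ennreal (C * len Q0)"
    proof
      fix Q0 :: "real set" assume Q0: "Q0 \<in> dyadic_intervals"
      obtain j k where jk: "Q0 = dint j k" using Q0 by (auto simp: dyadic_intervals_eq)
      show "(\<Sum>\<^sub>\<infinity>Q\<in>{Q\<in>\<B>. Q \<subseteq> Q0}. ennreal (len Q)) \<le> ennreal (C * len Q0)"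
        unfolding jk len_dint[of j k]
      proof (rule infsum_packing[where h = ix and P = "bad f \<epsilon>" and j = j and k = k])
        show "inj_on ix {Q \<in> \<B>. Q \<subseteq> dint j k}" by (auto simp: inj_on_def \<B>_def ix dint_eq_iff)
        show "desc_sum (\<lambda>j k. if bad f \<epsilon> j k then 2 powi j else 0) n j k \<le> C * 2 powi j" for n
          using C1(2)[of f n j k, OF lip] C(2)[of j] by linarith
      qed (auto simp: \<B>_def ix len_dint)
    qed
    moreover have "\<forall>\<T>\<in>\<F>. dyadic_tree \<T>" by (auto simp: \<F>_def dyadic_tree_tree)
    moreover have "disjoint \<F>"
      unfolding \<F>_def by (rule disjointI) (use tree_disjoint[of f \<epsilon>] in blast)
    moreover have "\<G> = \<Union>\<F>"
    proof
      show "\<G> \<subseteq> \<Union>\<F>"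
      proof
        fix Q assume "Q \<in> \<G>"
        then obtain j k where "Q = dint j k" "\<not> bad f \<epsilon> j k" by (auto simp: \<G>_def)
        thus "Q \<in> \<Union>\<F>"
          unfolding \<F>_def using root_tree_top[of f \<epsilon> j k]
          by (auto simp: dint_mem_tree intro!: exI[of _ "tree f \<epsilon> (fst (tree_top f \<epsilon> j k)) (snd (tree_top f \<epsilon> j k))"])
      qed
    qed (auto simp: \<F>_def \<G>_def tree_def)
    moreover have "\<forall>Q0\<in>dyadic_intervals.
        (\<Sum>\<^sub>\<infinity>\<T>\<in>{\<T>\<in>\<F>. top_interval \<T> \<subseteq> Q0}. ennreal (len (top_interval \<T>)))
          \<le> ennreal (C * len Q0)"
    proof
      fix Q0 :: "real set" assume Q0: "Q0 \<in> dyadic_intervals"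
      obtain j k where jk: "Q0 = dint j k" using Q0 by (auto simp: dyadic_intervals_eq)
      show "(\<Sum>\<^sub>\<infinity>\<T>\<in>{\<T>\<in>\<F>. top_interval \<T> \<subseteq> Q0}. ennreal (len (top_interval \<T>)))
          \<le> ennreal (C * len Q0)"
        unfolding jk len_dint[of j k]
      proof (rule infsum_packing[where h = "\<lambda>\<T>. ix (top_interval \<T>)" and P = "tree_root f \<epsilon>" and j = j and k = k])
        \<comment> \<open>A tree of \<open>\<F>\<close> is determined by its top interval.\<close>
        show "inj_on (\<lambda>\<T>. ix (top_interval \<T>)) {\<T> \<in> \<F>. top_interval \<T> \<subseteq> dint j k}"
          by (auto simp: inj_on_def \<F>_def ix top_interval_tree)
        show "desc_sum (\<lambda>j k. if tree_root f \<epsilon> j k then 2 powi j else 0) n j k \<le> C * 2 powi j" for n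
          using C2(2)[of f n j k, OF lip] C(3)[of j] by linarith
      qed (auto simp: \<F>_def ix len_dint top_interval_tree)
    qed
    moreover have "\<forall>\<T>\<in>\<F>. \<exists>\<L> \<psi>. L_tame_linear 2 \<L> \<and> tame_on \<eta> UNIV \<psi> \<and>
        (\<forall>Q\<in>\<T>. \<forall>s\<in>double_interval Q. d_par (\<phi> s) (\<psi> s + \<L> s) \<le> \<eta> * len Q)"
    proof
      fix \<T> assume "\<T> \<in> \<F>"
      then obtain J K where \<T>: "\<T> = tree f \<epsilon> J K" "tree_root f \<epsilon> J K" by (auto simp: \<F>_def)
      have "(snd \<circ> \<phi> has_real_derivative f x) (at x)" for x
        using tame_on_imp_deriv[OF \<phi>, of x] by (simp add: f_def o_def)
      from tree_approximation[OF lip this _ _ \<epsilon>_def \<T>(2)] \<eta>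
      show "\<exists>\<L> \<psi>. L_tame_linear 2 \<L> \<and> tame_on \<eta> UNIV \<psi> \<and>
        (\<forall>Q\<in>\<T>. \<forall>s\<in>double_interval Q. d_par (\<phi> s) (\<psi> s + \<L> s) \<le> \<eta> * len Q)"
        unfolding \<T>(1) by (simp add: f_def)
    qed
    ultimately show "\<exists>\<B> \<G> :: real set set.
          \<B> \<union> \<G> = dyadic_intervals \<and> \<B> \<inter> \<G> = {} \<and>
          (\<forall>Q0\<in>dyadic_intervals.
            (\<Sum>\<^sub>\<infinity>Q\<in>{Q\<in>\<B>. Q \<subseteq> Q0}. ennreal (len Q)) \<le> ennreal (C * len Q0)) \<and>
          (\<exists>\<F> :: real set set set.
            (\<forall>\<T>\<in>\<F>. dyadic_tree \<T>) \<and>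
            disjoint \<F> \<and>
            \<G> = \<Union>\<F> \<and>
            (\<forall>Q0\<in>dyadic_intervals.
              (\<Sum>\<^sub>\<infinity>\<T>\<in>{\<T>\<in>\<F>. top_interval \<T> \<subseteq> Q0}. ennreal (len (top_interval \<T>)))
                \<le> ennreal (C * len Q0)) \<and>
            (\<forall>\<T>\<in>\<F>. \<exists>\<L> \<psi> :: real \<Rightarrow> real \<times> real.
              L_tame_linear 2 \<L> \<and> tame_on \<eta> UNIV \<psi> \<and>
              (\<forall>Q\<in>\<T>. \<forall>s\<in>double_interval Q.
                d_par (\<phi> s) (\<psi> s + \<L> s) \<le> \<eta> * len Q)))"
      by - (rule exI[of _ \<B>], rule exI[of _ \<G>], intro conjI exI[of _ \<F>]; assumption)
  qed (use C in simp)
qed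

end
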